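(* Let $G$ be a subgroup of $PL_+(I)$ generated by a finite set $X$. The following are equivalent. (1) $G$ is not soluble. (2) $G$ admits a transition chain. (3) $G$ admits a one-sided overlap. (4) $G$ admits a tower of infinite height. Moreover, if $G$ is soluble, the derived length of $G$ is less than or equal to the cardinality of the set $\mathscr{B}_X$ of breakpoints of elements of $X$.
   Context: $PL_+(I)$ is the group of orientation-preserving piecewise-linear homeomorphisms of $I=[0,1]$ with finitely many breaks in slope, acting on the right. The support of $g$ is $\{x\in[0,1] : xg\neq x\}$, an open set; a component of support of $g$ is a connected component of it (an open interval). A point $x\in(0,1)$ is a breakpoint of $g$ if the derivative of $g$ does not exist at $x$; for $X\subset PL_+(I)$, $\mathscr{B}_X=\{x\in(0,1) : x \text{ is a breakpoint of some } g\in X\}$. $G$ admits a transition chain if there are $g,h\in G$ with components of support $(a,b)$ and $(c,d)$, respectively, such that $a<c<b<d$. $G$ admits a one-sided overlap if there are $g,h\in G$ with components of support $(a,b),(a,c)$, respectively, or $(a,b),(c,b)$, respectively, such that $a<c<b$. $G$ admits a tower of infinite height if there is an infinite sequence $\{g_i\}_{i\in\mathbb{N}}$ of elements of $G$ with components of support $A_i$, respectively, such that $A_{i+1}\subsetneq A_i$ for all $i$. The trivial group is soluble of derived length $0$. *)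

theory Defs
  imports "HOL-Analysis.Analysis" "HOL-Algebra.Solvable_Groups"
begin

section \<open>The group of piecewise-linear homeomorphisms of the unit interval\<close>

definition piecewise_linear_on_I :: "(real \<Rightarrow> real) \<Rightarrow> bool" where
  "piecewise_linear_on_I f \<longleftrightarrow>
    (\<exists>S. finite S \<and>
      (\<forall>a b. 0 \<le> a \<and> a \<le> b \<and> b \<le> 1 \<and> S \<inter> {a<..<b} = {} \<longrightarrow>
        (\<exists>m c. \<forall>x\<in>{a..b}. f x = m * x + c)))"

text \<open>Elements are taken extensional on the unit interval, so that two of them are equal as
  HOL functions iff they agree as maps of the interval.\<close>

definition PL_homeos :: "(real \<Rightarrow> real) set" where
  "PL_homeos =
    {f \<in> extensional {0..1}. (\<exists>f'. homeomorphism {0..1} {0..1} f f') \<and>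
       strict_mono_on {0..1} f \<and> piecewise_linear_on_I f}"

text \<open>Maps act on the right: the product \<open>f g\<close> means first \<open>f\<close>, then \<open>g\<close>.\<close>

definition PL_I :: "(real \<Rightarrow> real) monoid" where
  "PL_I = \<lparr>carrier = PL_homeos, mult = (\<lambda>f g. compose {0..1} g f), one = (\<lambda>x\<in>{0..1}. x)\<rparr>"

definition support :: "(real \<Rightarrow> real) \<Rightarrow> real set" where
  "support g = {x \<in> {0..1}. g x \<noteq> x}"

definition breakpoints :: "(real \<Rightarrow> real) set \<Rightarrow> real set" where
  "breakpoints X = {x \<in> {0<..<1}. \<exists>g\<in>X. \<not> g differentiable (at x)}"

definition transition_chain :: "(real \<Rightarrow> real) set \<Rightarrow> bool" where
  "transition_chain G \<longleftrightarrow>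
    (\<exists>g\<in>G. \<exists>h\<in>G. \<exists>a b c d.
      {a<..<b} \<in> components (support g) \<and> {c<..<d} \<in> components (support h) \<and>
      a < c \<and> c < b \<and> b < d)"

definition one_sided_overlap :: "(real \<Rightarrow> real) set \<Rightarrow> bool" where
  "one_sided_overlap G \<longleftrightarrow>
    (\<exists>g\<in>G. \<exists>h\<in>G. \<exists>a b c. a < c \<and> c < b \<and>
      {a<..<b} \<in> components (support g) \<and>
      ({a<..<c} \<in> components (support h) \<or> {c<..<b} \<in> components (support h)))"

definition infinite_tower :: "(real \<Rightarrow> real) set \<Rightarrow> bool" where
  "infinite_tower G \<longleftrightarrow>
    (\<exists>(g :: nat \<Rightarrow> real \<Rightarrow> real) A. \<forall>i.
      g i \<in> G \<and> A i \<in> components (support (g i)) \<and> A (Suc i) \<subset> A i)"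

text \<open>Only meaningful for soluble groups; the trivial group gets derived length \<open>0\<close>.\<close>

definition derived_length :: "('a, 'b) monoid_scheme \<Rightarrow> nat" where
  "derived_length G = (LEAST n. (derived G ^^ n) (carrier G) = {\<one>\<^bsub>G\<^esub>})"


section \<open>It is indeed a group\<close>

lemma PL_homeosD:
  assumes "f \<in> PL_homeos"
  shows "f \<in> extensional {0..1}" "bij_betw f {0..1} {0..1}" "continuous_on {0..1} f"
    "strict_mono_on {0..1} f" "piecewise_linear_on_I f"
  using assms
  by (auto simp: PL_homeos_def homeomorphism_def intro!: bij_betw_imageI strict_mono_on_imp_inj_on)

lemma PL_homeosI:
  assumes "f \<in> extensional {0..1}" "f ` {0..1} = {0..1}" "continuous_on {0..1} f"
    "strict_mono_on {0..1} f" "piecewise_linear_on_I f"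
  shows "f \<in> PL_homeos"
proof -
  have "inj_on f {0..1}"
    using assms(4) by (rule strict_mono_on_imp_inj_on)
  with assms show ?thesis
    unfolding PL_homeos_def by (auto intro: homeomorphism_compact[of "{0..1}" f "{0..1}"])
qed

lemma PL_homeos_id: "(\<lambda>x\<in>{0..1}. x) \<in> PL_homeos"
proof (rule PL_homeosI)
  show "piecewise_linear_on_I (\<lambda>x\<in>{0..1}. x)"
    unfolding piecewise_linear_on_I_def
  proof (intro exI[of _ "{}"] conjI allI impI)
    fix a b :: real
    assume "0 \<le> a \<and> a \<le> b \<and> b \<le> 1 \<and> {} \<inter> {a<..<b} = {}"
    then have "\<forall>x\<in>{a..b}. (\<lambda>x\<in>{0..1}. x) x = 1 * x + 0" by auto
    then show "\<exists>m c. \<forall>x\<in>{a..b}. (\<lambda>x\<in>{0..1}. x) x = m * x + c" by blast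
  qed simp
  show "continuous_on {0..1} (\<lambda>x\<in>{0..1::real}. x)"
    by (rule continuous_on_eq[OF continuous_on_id]) simp
qed (auto simp: strict_mono_on_def)

lemma PL_homeos_compose:
  assumes f: "f \<in> PL_homeos" and g: "g \<in> PL_homeos"
  shows "compose {0..1} g f \<in> PL_homeos"
proof (rule PL_homeosI)
  note F = PL_homeosD[OF f] and G = PL_homeosD[OF g]
  have fim: "f ` {0..1} = {0..1}" and gim: "g ` {0..1} = {0..1}"
    using F(2) G(2) by (auto simp: bij_betw_def)
  show "compose {0..1} g f ` {0..1} = {0..1}"
    using bij_betw_compose[OF F(2) G(2)] by (simp add: bij_betw_def)
  have "continuous_on {0..1} (g \<circ> f)"
    using F(3) G(3) fim by (intro continuous_on_compose) auto
  then show "continuous_on {0..1} (compose {0..1} g f)"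
    by (rule continuous_on_eq) (auto simp: compose_def)
  have fI: "f x \<in> {0..1}" if "x \<in> {0..1}" for x
    using fim that by blast
  show "strict_mono_on {0..1} (compose {0..1} g f)"
    using fI by (auto simp: compose_def
      intro!: strict_mono_onI strict_mono_onD[OF G(4)] strict_mono_onD[OF F(4)])
  obtain S where S: "finite S"
    "\<And>a b. 0 \<le> a \<Longrightarrow> a \<le> b \<Longrightarrow> b \<le> 1 \<Longrightarrow> S \<inter> {a<..<b} = {} \<Longrightarrow>
       \<exists>m c. \<forall>x\<in>{a..b}. f x = m * x + c"
    using F(5) unfolding piecewise_linear_on_I_def by metis
  obtain T where T: "finite T"
    "\<And>a b. 0 \<le> a \<Longrightarrow> a \<le> b \<Longrightarrow> b \<le> 1 \<Longrightarrow> T \<inter> {a<..<b} = {} \<Longrightarrow>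
       \<exists>m c. \<forall>x\<in>{a..b}. g x = m * x + c"
    using G(5) unfolding piecewise_linear_on_I_def by metis
  define U where "U = S \<union> (f -` T \<inter> {0..1})"
  have "finite U"
    unfolding U_def using S(1) T(1) F(2) by (auto simp: bij_betw_def intro: finite_vimage_IntI)
  moreover have "\<exists>m c. \<forall>x\<in>{a..b}. compose {0..1} g f x = m * x + c"
    if ab: "0 \<le> a" "a \<le> b" "b \<le> 1" and U: "U \<inter> {a<..<b} = {}" for a b
  proof -
    obtain m c where mc: "\<forall>x\<in>{a..b}. f x = m * x + c"
      using S(2)[of a b] ab U unfolding U_def by blast
    have mono: "f x \<le> f y" if "x \<in> {0..1}" "y \<in> {0..1}" "x \<le> y" for x y
      using that strict_mono_on_leD[OF F(4)] by auto
    have "T \<inter> {f a<..<f b} = {}"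
    proof (rule ccontr)
      assume "T \<inter> {f a<..<f b} \<noteq> {}"
      then obtain y where y: "y \<in> T" "f a < y" "y < f b" by auto
      have "y \<in> {0..1}"
        using y fI[of a] fI[of b] ab by auto
      then obtain x where x: "x \<in> {0..1}" "y = f x"
        using fim by blast
      have "a < x" "x < b"
        using y x mono[of x a] mono[of b x] ab by (auto simp: not_le[symmetric])
      with x y U show False unfolding U_def by auto
    qed
    moreover have "f a \<le> f b" using mono ab by auto
    ultimately obtain m' c' where mc': "\<forall>x\<in>{f a..f b}. g x = m' * x + c'"
      using T(2)[of "f a" "f b"] fI[of a] fI[of b] ab by auto
    have "compose {0..1} g f x = (m' * m) * x + (m' * c + c')" if "x \<in> {a..b}" for x
    proof -
      have "f x \<in> {f a..f b}" using mono[of a x] mono[of x b] that ab by auto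
      then have "g (f x) = m' * f x + c'" using mc' by blast
      then show ?thesis
        using mc that ab by (auto simp: compose_def algebra_simps)
    qed
    then show ?thesis by blast
  qed
  ultimately show "piecewise_linear_on_I (compose {0..1} g f)"
    unfolding piecewise_linear_on_I_def by (intro exI[of _ U]) simp
qed (simp add: compose_def)

lemma PL_homeos_inv:
  assumes f: "f \<in> PL_homeos"
  shows "restrict (inv_into {0..1} f) {0..1} \<in> PL_homeos" (is "?h \<in> _")
proof (rule PL_homeosI)
  note F = PL_homeosD[OF f]
  have fim: "f ` {0..1} = {0..1}" and inj: "inj_on f {0..1}"
    using F(2) by (auto simp: bij_betw_def)
  have hI: "?h y \<in> {0..1}" and fh: "f (?h y) = y" if "y \<in> {0..1}" for y
    using that fim inv_into_into[of y f "{0..1}"] f_inv_into_f[of y f "{0..1}"] by auto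
  have hf: "?h (f x) = x" if "x \<in> {0..1}" for x
    using that fim inj by (auto simp: inv_into_f_f)
  show "?h ` {0..1} = {0..1}"
  proof
    show "?h ` {0..1} \<subseteq> {0..1}" using hI by blast
    show "{0..1} \<subseteq> ?h ` {0..1}"
    proof
      fix x :: real assume "x \<in> {0..1}"
      then have "x = ?h (f x)" "f x \<in> {0..1}" using hf fim by auto
      then show "x \<in> ?h ` {0..1}" by (rule image_eqI)
    qed
  qed
  obtain k where k: "homeomorphism {0..1} {0..1} f k"
    using f unfolding PL_homeos_def by blast
  have "continuous_on {0..1} k" using k by (simp add: homeomorphism_def)
  moreover have "k y = ?h y" if "y \<in> {0..1}" for y
    proof -
    have "k y \<in> {0..1}" "f (k y) = y" using k that by (auto simp: homeomorphism_def)
    then show ?thesis using hf[of "k y"] by simp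
  qed
  ultimately show "continuous_on {0..1} ?h"
    using continuous_on_eq by blast
  show sm: "strict_mono_on {0..1} ?h"
  proof (rule strict_mono_onI)
    fix x y :: real assume xy: "x \<in> {0..1}" "y \<in> {0..1}" "x < y"
    show "?h x < ?h y"
    proof (rule ccontr)
      assume "\<not> ?h x < ?h y"
      then have "f (?h y) \<le> f (?h x)"
        using strict_mono_on_leD[OF F(4)] hI xy by (meson not_less)
      with fh xy show False by simp
    qed
  qed
  obtain S where S: "finite S"
    "\<And>a b. 0 \<le> a \<Longrightarrow> a \<le> b \<Longrightarrow> b \<le> 1 \<Longrightarrow> S \<inter> {a<..<b} = {} \<Longrightarrow>
       \<exists>m c. \<forall>x\<in>{a..b}. f x = m * x + c"
    using F(5) unfolding piecewise_linear_on_I_def by metis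
  have "\<exists>m c. \<forall>y\<in>{a..b}. ?h y = m * y + c"
    if ab: "0 \<le> a" "a \<le> b" "b \<le> 1" and U: "f ` S \<inter> {a<..<b} = {}" for a b
  proof (cases "a = b")
    case True
    then have "\<forall>y\<in>{a..b}. ?h y = 0 * y + ?h a" by auto
    then show ?thesis by blast
  next
    case False
    have I: "a \<in> {0..1}" "b \<in> {0..1}" "a < b" using ab False by auto
    have lt: "?h a < ?h b" using strict_mono_onD[OF sm] I by blast
    have "S \<inter> {?h a<..<?h b} = {}"
    proof (rule ccontr)
      assume "S \<inter> {?h a<..<?h b} \<noteq> {}"
      then obtain x where x: "x \<in> S" "?h a < x" "x < ?h b" by auto
      have xI: "x \<in> {0..1}" using x hI[OF I(1)] hI[OF I(2)] by simp
      have "f (?h a) < f x" "f x < f (?h b)"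
        using strict_mono_onD[OF F(4)] hI I xI x by blast+
      then have "f x \<in> f ` S \<inter> {a<..<b}" using x fh I by simp
      with U show False by blast
    qed
    then obtain m c where mc: "\<forall>x\<in>{?h a..?h b}. f x = m * x + c"
      using S(2)[of "?h a" "?h b"] hI[OF I(1)] hI[OF I(2)] lt by auto
    have "f (?h a) = m * ?h a + c" "f (?h b) = m * ?h b + c"
      using mc lt by (meson atLeastAtMost_iff order_refl less_imp_le)+
    then have m: "m \<noteq> 0" using fh I by force
    have "?h y = (1 / m) * y + (- c / m)" if "y \<in> {a..b}" for y
    proof -
      have yI: "y \<in> {0..1}" using that ab by auto
      have "?h y \<in> {?h a..?h b}"
        using strict_mono_on_leD[OF sm] I yI that by (meson atLeastAtMost_iff)
      then have "f (?h y) = m * ?h y + c" using mc by blast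
      then have "y = m * ?h y + c" using fh[OF yI] by argo
      then have "?h y = (y - c) / m" using m by (simp add: eq_divide_eq mult.commute)
      then show ?thesis by (simp only: diff_divide_distrib) simp
    qed
    then show ?thesis by blast
  qed
  moreover have "finite (f ` S)" using S(1) by blast
  ultimately show "piecewise_linear_on_I ?h"
    unfolding piecewise_linear_on_I_def by (intro exI[of _ "f ` S"]) simp
qed simp

lemma group_PL_I: "group PL_I"
proof (rule groupI)
  fix f g h assume *: "f \<in> carrier PL_I" "g \<in> carrier PL_I" "h \<in> carrier PL_I"
  have "f ` {0..1} = {0..1}"
    using * PL_homeosD(2)[of f] by (simp add: PL_I_def bij_betw_def)
  then show "f \<otimes>\<^bsub>PL_I\<^esub> g \<otimes>\<^bsub>PL_I\<^esub> h = f \<otimes>\<^bsub>PL_I\<^esub> (g \<otimes>\<^bsub>PL_I\<^esub> h)"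
    by (intro ext) (force simp: PL_I_def compose_def)
next
  fix f assume "f \<in> carrier PL_I"
  then have f: "f \<in> PL_homeos" by (simp add: PL_I_def)
  have "f x = undefined" if "x \<notin> {0..1}" for x
    using PL_homeosD(1)[OF f] that by (auto simp: extensional_def)
  then show "\<one>\<^bsub>PL_I\<^esub> \<otimes>\<^bsub>PL_I\<^esub> f = f"
    by (intro ext) (auto simp: PL_I_def compose_def)
  have "f ` {0..1} = {0..1}"
    using PL_homeosD(2)[OF f] by (simp add: bij_betw_def)
  then have "restrict (inv_into {0..1} f) {0..1} \<otimes>\<^bsub>PL_I\<^esub> f = \<one>\<^bsub>PL_I\<^esub>"
    by (intro ext) (simp add: PL_I_def compose_def f_inv_into_f)
  then show "\<exists>g\<in>carrier PL_I. g \<otimes>\<^bsub>PL_I\<^esub> f = \<one>\<^bsub>PL_I\<^esub>"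
    using PL_homeos_inv[OF f] by (intro bexI) (auto simp: PL_I_def)
qed (auto simp: PL_I_def PL_homeos_id PL_homeos_compose)

end

theory Submission
  imports Defs
begin

text \<open>
  An orbital is a component of support. Two orbitals of \<open>g\<close>, \<open>h\<close> forming a chain \<open>a < c < b < d\<close>, with \<open>d\<close>
  maximal, give a one-sided overlap \<open>(c, d)\<close>, \<open>(cg, d)\<close>, and an orbital that is strictly nested with
  one of its translates generates an infinite tower. A tower in \<open>H\<close> produces one in \<open>H'\<close>, because
  germs of commutators at a common fixed point are trivial; hence a group with a tower is not soluble.

  Conversely, suppose that there is no chain. Finitely many elements then have a common orbital around
  each point that one of them moves, so every orbital of an element of \<open>H'\<close> lies strictly inside an
  orbital of \<open>H\<close>, and a nontrivial \<open>n\<close>-th derived group gives \<open>n + 1\<close> strictly nested orbitals of \<open>G\<close>.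
  The translates of an orbital are equal or disjoint, and in each step of the nest there is a break
  outside all translates of the next smaller orbital. So there are \<open>n + 1\<close> orbits of breaks, each of
  which meets the set of breakpoints of the generators.
\<close>

section \<open>Orbitals of real functions\<close>

text \<open>The four conditions form a cycle, but its last implication needs more than the cycle
  supplies: the absence of chains must also exclude overlaps, hence the separate proof that an
  overlap yields a chain. Towers are of no help there, since they give chains only through
  insolubility, the very implication being proved.

  Derived subgroups may fail to be finitely generated, so the statements on towers, overlaps and
  chains concern arbitrary subgroups. Finiteness enters elsewhere: one element has finitely many
  orbitals, which permits extremal choices, and one element of the derived subgroup involves only
  finitely many elements of the group.

  The descent of towers splits. Without overlaps, an orbital strictly enclosed by another survives
  unchanged as an orbital of a commutator. With an overlap, the given tower is dropped and a
  commutator formed from the overlapping pair forces a new one.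

  Orbits of breaks are told apart because a point outside all translates of an interval shares no
  orbit with a point inside it.\<close>

definition orbital :: "(real \<Rightarrow> real) \<Rightarrow> real \<Rightarrow> real \<Rightarrow> bool" where
  "orbital \<phi> a b \<longleftrightarrow> a < b \<and> \<phi> a = a \<and> \<phi> b = b \<and> (\<forall>x. a < x \<and> x < b \<longrightarrow> \<phi> x \<noteq> x)"

definition has_chain :: "('g \<Rightarrow> real \<Rightarrow> real) \<Rightarrow> 'g set \<Rightarrow> bool" where
  "has_chain E H \<longleftrightarrow> (\<exists>g\<in>H. \<exists>h\<in>H. \<exists>a b c d.
     orbital (E g) a b \<and> orbital (E h) c d \<and> a < c \<and> c < b \<and> b < d)"

definition has_left_overlap :: "('g \<Rightarrow> real \<Rightarrow> real) \<Rightarrow> 'g set \<Rightarrow> bool" where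
  "has_left_overlap E H \<longleftrightarrow> (\<exists>g\<in>H. \<exists>h\<in>H. \<exists>a b c.
     orbital (E g) a b \<and> orbital (E h) a c \<and> c < b)"

definition has_right_overlap :: "('g \<Rightarrow> real \<Rightarrow> real) \<Rightarrow> 'g set \<Rightarrow> bool" where
  "has_right_overlap E H \<longleftrightarrow> (\<exists>g\<in>H. \<exists>h\<in>H. \<exists>a b c.
     orbital (E g) a b \<and> orbital (E h) c b \<and> a < c)"

definition has_tower :: "('g \<Rightarrow> real \<Rightarrow> real) \<Rightarrow> 'g set \<Rightarrow> bool" where
  "has_tower E H \<longleftrightarrow> (\<exists>g a b. \<forall>i::nat. g i \<in> H \<and> orbital (E (g i)) (a i) (b i) \<and>
     a i \<le> a (Suc i) \<and> b (Suc i) \<le> b i \<and> (a i < a (Suc i) \<or> b (Suc i) < b i))"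

text \<open>Conjugating by \<open>x \<mapsto> -x\<close> exchanges left and right; statements about right ends of orbitals
  are obtained from those about left ends by this symmetry.\<close>

definition mirror :: "('g \<Rightarrow> real \<Rightarrow> real) \<Rightarrow> 'g \<Rightarrow> real \<Rightarrow> real" where
  "mirror E = (\<lambda>f x. - E f (- x))"

text \<open>Stands in for differentiability: its failure is a break, and it passes to products and
  inverses by mere substitution. \<open>differentiable_imp_locally_affine\<close> gives the link
  back.\<close>

definition locally_affine :: "(real \<Rightarrow> real) \<Rightarrow> real \<Rightarrow> bool" where
  "locally_affine \<phi> t \<longleftrightarrow> (\<exists>m c. eventually (\<lambda>x. \<phi> x = m * x + c) (nhds t))"

lemma mirror_mirror [simp]: "mirror (mirror E) = E"
  by (simp add: mirror_def)

lemma orbital_mirror [simp]: "orbital (mirror E f) a b \<longleftrightarrow> orbital (E f) (- b) (- a)"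
proof -
  have *: "(\<forall>x. a < x \<and> x < b \<longrightarrow> - E f (- x) \<noteq> x) \<longleftrightarrow> (\<forall>x. - b < x \<and> x < - a \<longrightarrow> E f x \<noteq> x)"
  proof safe
    fix x assume "\<forall>x. a < x \<and> x < b \<longrightarrow> - E f (- x) \<noteq> x" "- b < x" "x < - a" "E f x = x"
    then show False by (auto dest: spec[of _ "- x"])
  next
    fix x assume "\<forall>x. - b < x \<and> x < - a \<longrightarrow> E f x \<noteq> x" "a < x" "x < b" "- E f (- x) = x"
    then show False by (auto dest!: spec[of _ "- x"])
  qed
  show ?thesis
    unfolding orbital_def mirror_def * by (auto simp: minus_equation_iff)
qed

lemma has_chain_mirrorD: "has_chain (mirror E) H \<Longrightarrow> has_chain E H"
  unfolding has_chain_def orbital_mirror by (metis neg_less_iff_less)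

lemma has_left_overlap_mirrorD: "has_left_overlap (mirror E) H \<Longrightarrow> has_right_overlap E H"
  unfolding has_left_overlap_def has_right_overlap_def orbital_mirror by (metis neg_less_iff_less)

lemma has_right_overlap_mirrorD: "has_right_overlap (mirror E) H \<Longrightarrow> has_left_overlap E H"
  unfolding has_left_overlap_def has_right_overlap_def orbital_mirror by (metis neg_less_iff_less)

lemma has_tower_mirrorD: "has_tower (mirror E) H \<Longrightarrow> has_tower E H"
proof -
  assume "has_tower (mirror E) H"
  then obtain g a b where "\<forall>i::nat. g i \<in> H \<and> orbital (E (g i)) (- b i) (- a i) \<and>
     a i \<le> a (Suc i) \<and> b (Suc i) \<le> b i \<and> (a i < a (Suc i) \<or> b (Suc i) < b i)"
    unfolding has_tower_def orbital_mirror by blast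
  then show ?thesis
    unfolding has_tower_def
    by (intro exI[of _ g] exI[of _ "\<lambda>i. - b i"] exI[of _ "\<lambda>i. - a i"]) auto
qed

lemma has_chain_mirror [simp]: "has_chain (mirror E) H \<longleftrightarrow> has_chain E H"
  using has_chain_mirrorD mirror_mirror by metis

lemma has_left_overlap_mirror [simp]: "has_left_overlap (mirror E) H \<longleftrightarrow> has_right_overlap E H"
  using has_left_overlap_mirrorD has_right_overlap_mirrorD mirror_mirror by metis

lemma has_tower_mirror [simp]: "has_tower (mirror E) H \<longleftrightarrow> has_tower E H"
  using has_tower_mirrorD mirror_mirror by metis

text \<open>Ends are fixed and interior points are moved, so no end of one interval can lie inside
  the other.\<close>

lemma orbitals_meet_eq:
  assumes "orbital \<phi> a b" "orbital \<phi> c d" "c < b" "a < d"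
  shows "a = c" "b = d"
  using assms unfolding orbital_def by (metis linorder_neqE_linordered_idom)+

section \<open>Piecewise linear actions on the line\<close>

text \<open>The maps act on the whole line, so no argument carries a domain condition. The axioms
  record piecewise linearity only as affine one-sided germs and finiteness of orbitals, a form
  stable under reflection; \<open>E_bounded\<close> provides fixed points on both sides of every
  point.\<close>

locale pl_action = group G for G (structure) +
  fixes E :: "'a \<Rightarrow> real \<Rightarrow> real"
  assumes E_mult: "f \<in> carrier G \<Longrightarrow> g \<in> carrier G \<Longrightarrow> E (f \<otimes> g) x = E g (E f x)"
    and E_strict_mono: "f \<in> carrier G \<Longrightarrow> strict_mono (E f)"
    and E_continuous: "f \<in> carrier G \<Longrightarrow> continuous_on UNIV (E f)"
    and E_faithful: "f \<in> carrier G \<Longrightarrow> (\<And>x. E f x = x) \<Longrightarrow> f = \<one>"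
    and E_bounded: "f \<in> carrier G \<Longrightarrow> \<exists>M. \<forall>x. M \<le> \<bar>x\<bar> \<longrightarrow> E f x = x"
    and E_right: "f \<in> carrier G \<Longrightarrow> \<exists>m c. eventually (\<lambda>x. E f x = m * x + c) (at_right z)"
    and E_left: "f \<in> carrier G \<Longrightarrow> \<exists>m c. eventually (\<lambda>x. E f x = m * x + c) (at_left z)"
    and E_finite: "f \<in> carrier G \<Longrightarrow> finite {(a, b). orbital (E f) a b}"
begin

lemma pl_action_mirror: "pl_action G (mirror E)"
proof unfold_locales
  fix f assume f: "f \<in> carrier G"
  show "strict_mono (mirror E f)"
    using E_strict_mono[OF f] by (auto simp: strict_mono_def mirror_def)
  show "continuous_on UNIV (mirror E f)"
    unfolding mirror_def
    by (rule continuous_on_minus, rule continuous_on_compose2[OF E_continuous[OF f]])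
      (auto intro: continuous_intros)
  show "f = \<one>" if "\<And>x. mirror E f x = x"
  proof (rule E_faithful[OF f])
    fix x show "E f x = x" using that[of "- x"] by (simp add: mirror_def)
  qed
  show "\<exists>M. \<forall>x. M \<le> \<bar>x\<bar> \<longrightarrow> mirror E f x = x"
    using E_bounded[OF f] unfolding mirror_def by (metis abs_minus_cancel minus_minus)
  fix z
  obtain m c where "eventually (\<lambda>x. E f x = m * x + c) (at_left (- z))"
    using E_left[OF f] by blast
  then have "eventually (\<lambda>x. mirror E f x = m * x + (- c)) (at_right z)"
    by (auto simp: at_left_minus eventually_filtermap mirror_def elim!: eventually_mono)
  then show "\<exists>m c. eventually (\<lambda>x. mirror E f x = m * x + c) (at_right z)" by blast
  obtain m c where "eventually (\<lambda>x. E f x = m * x + c) (at_right (- z))"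
    using E_right[OF f] by blast
  then have "eventually (\<lambda>x. mirror E f x = m * x + (- c)) (at_left z)"
    by (auto simp: at_right_minus eventually_filtermap mirror_def elim!: eventually_mono)
  then show "\<exists>m c. eventually (\<lambda>x. mirror E f x = m * x + c) (at_left z)" by blast
  have "{(a, b). orbital (mirror E f) a b} \<subseteq> (\<lambda>(a, b). (- b, - a)) ` {(a, b). orbital (E f) a b}"
    by (force simp: image_iff)
  then show "finite {(a, b). orbital (mirror E f) a b}"
    using finite_subset finite_imageI[OF E_finite[OF f]] by blast
qed (auto simp: mirror_def E_mult)

section \<open>Orbitals, conjugation and directions of motion\<close>

lemma E_less [simp]: "f \<in> carrier G \<Longrightarrow> E f x < E f y \<longleftrightarrow> x < y"
  by (simp add: E_strict_mono strict_mono_less)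

lemma E_le [simp]: "f \<in> carrier G \<Longrightarrow> E f x \<le> E f y \<longleftrightarrow> x \<le> y"
  by (simp add: E_strict_mono strict_mono_less_eq)

lemma E_eq [simp]: "f \<in> carrier G \<Longrightarrow> E f x = E f y \<longleftrightarrow> x = y"
  by (simp add: E_strict_mono strict_mono_eq)

lemma E_one [simp]: "E \<one> x = x"
  using E_mult[of \<one> \<one> x] E_eq[of \<one> "E \<one> x" x] by simp

lemma E_inv [simp]: "f \<in> carrier G \<Longrightarrow> E (inv f) (E f x) = x"
  "f \<in> carrier G \<Longrightarrow> E f (E (inv f) x) = x"
  using E_mult[of f "inv f" x] E_mult[of "inv f" f x] by simp_all

lemma E_inv_less_iff: "f \<in> carrier G \<Longrightarrow> E (inv f) x < y \<longleftrightarrow> x < E f y"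
  by (metis E_inv(2) E_less)

lemma less_E_inv_iff: "f \<in> carrier G \<Longrightarrow> x < E (inv f) y \<longleftrightarrow> E f x < y"
  by (metis E_inv(2) E_less)

lemma E_inv_eq_iff: "f \<in> carrier G \<Longrightarrow> E (inv f) x = y \<longleftrightarrow> x = E f y"
  by (metis E_inv)

lemma E_inv_fix_iff [simp]: "f \<in> carrier G \<Longrightarrow> E (inv f) x = x \<longleftrightarrow> E f x = x"
  by (metis E_inv)

lemma orbital_inv [simp]: "f \<in> carrier G \<Longrightarrow> orbital (E (inv f)) a b \<longleftrightarrow> orbital (E f) a b"
  by (simp add: orbital_def)

lemma E_conj:
  assumes "f \<in> carrier G" "w \<in> carrier G"
  shows "E (inv w \<otimes> f \<otimes> w) x = E w (E f (E (inv w) x))"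
  using assms by (simp add: E_mult)

lemma orbital_conj:
  assumes f: "f \<in> carrier G" and w: "w \<in> carrier G" and o: "orbital (E f) a b"
  shows "orbital (E (inv w \<otimes> f \<otimes> w)) (E w a) (E w b)"
proof -
  have "E f (E (inv w) x) \<noteq> E (inv w) x" if "E w a < x" "x < E w b" for x
    using o that w by (auto simp: orbital_def E_inv_less_iff less_E_inv_iff)
  then show ?thesis
    using o w f by (auto simp: orbital_def E_conj) (metis E_inv(1))
qed

text \<open>The ends are the nearest fixed points on either side of \<open>x\<close>; they exist
  because the fixed set is closed and, by \<open>E_bounded\<close>, unbounded in both
  directions.\<close>

lemma ex_orbital:
  assumes f: "f \<in> carrier G" and x: "E f x \<noteq> x"
  shows "\<exists>a b. a < x \<and> x < b \<and> orbital (E f) a b"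
proof -
  obtain M where M: "\<And>y. M \<le> \<bar>y\<bar> \<Longrightarrow> E f y = y" using E_bounded[OF f] by blast
  have cl: "closed {y. E f y = y}"
    by (intro closed_Collect_eq E_continuous[OF f] continuous_on_id)
  define L where "L = {y. E f y = y} \<inter> {..x}"
  define R where "R = {y. E f y = y} \<inter> {x..}"
  have cL: "closed L" and cR: "closed R" unfolding L_def R_def using cl by auto
  have "- \<bar>M\<bar> - \<bar>x\<bar> \<in> L" "\<bar>M\<bar> + \<bar>x\<bar> \<in> R"
    unfolding L_def R_def by (auto intro!: M)
  then have ne: "L \<noteq> {}" "R \<noteq> {}" by auto
  have bd: "bdd_above L" "bdd_below R" unfolding L_def R_def by auto
  have SL: "Sup L \<in> L" and IR: "Inf R \<in> R"
    using closed_contains_Sup[OF ne(1) bd(1) cL] closed_contains_Inf[OF ne(2) bd(2) cR] by auto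
  have "E f (Sup L) = Sup L" "Sup L \<le> x" "E f (Inf R) = Inf R" "x \<le> Inf R"
    using SL IR by (simp_all add: L_def R_def)
  then have lt: "Sup L < x" "x < Inf R" and fixed: "E f (Sup L) = Sup L" "E f (Inf R) = Inf R"
    using x by (metis order_le_less)+
  have "E f y \<noteq> y" if "Sup L < y" "y < Inf R" for y
  proof
    assume "E f y = y"
    then have "y \<in> L \<or> y \<in> R" unfolding L_def R_def by auto
    then show False using cSup_upper[OF _ bd(1)] cInf_lower[OF _ bd(2)] that by fastforce
  qed
  then have "orbital (E f) (Sup L) (Inf R)"
    unfolding orbital_def using lt fixed order.strict_trans[OF lt] by blast
  then show ?thesis using lt by blast
qed

lemma orbital_moves:
  assumes "f \<in> carrier G" "orbital (E f) a b" "a < x" "x < b"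
  shows "a < E f x" "E f x < b"
  using assms by (metis orbital_def E_less)+

text \<open>The displacement is continuous and has no zero inside an orbital, so it cannot change
  sign.\<close>

lemma orbital_direction:
  assumes f: "f \<in> carrier G" and o: "orbital (E f) a b"
  shows "(\<forall>x. a < x \<and> x < b \<longrightarrow> x < E f x) \<or> (\<forall>x. a < x \<and> x < b \<longrightarrow> E f x < x)"
proof (rule ccontr)
  assume "\<not> ?thesis"
  then obtain x y where x: "a < x" "x < b" "\<not> x < E f x" and y: "a < y" "y < b" "\<not> E f y < y"
    by blast
  have neq: "E f z \<noteq> z" if "a < z" "z < b" for z using o that by (auto simp: orbital_def)
  have "connected ((\<lambda>z. E f z - z) ` {a<..<b})"
    by (intro connected_continuous_image continuous_intros continuous_on_subset[OF E_continuous[OF f]]) auto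
  moreover have "E f x - x \<in> (\<lambda>z. E f z - z) ` {a<..<b}" "E f y - y \<in> (\<lambda>z. E f z - z) ` {a<..<b}"
    using x y by auto
  moreover have "E f x - x \<le> 0" "0 \<le> E f y - y" using x y by auto
  ultimately have "0 \<in> (\<lambda>z. E f z - z) ` {a<..<b}"
    by (meson connectedD_interval)
  then show False using neq by auto
qed

text \<open>Either \<open>f\<close> or its inverse will do. Since the fixed points agree, the result
  has the same orbitals as \<open>f\<close>.\<close>

lemma orbital_right_mover:
  assumes H: "subgroup H G" and f: "f \<in> H" and o: "orbital (E f) a b"
  obtains g where "g \<in> H" "\<And>x. E g x = x \<longleftrightarrow> E f x = x" "\<And>x. a < x \<Longrightarrow> x < b \<Longrightarrow> x < E g x"
proof -
  have fc: "f \<in> carrier G" using H f by (rule subgroup.mem_carrier)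
  show thesis
  proof (cases "\<forall>x. a < x \<and> x < b \<longrightarrow> x < E f x")
    case True
    then show thesis using f that by blast
  next
    case False
    then have "\<forall>x. a < x \<and> x < b \<longrightarrow> E f x < x" using orbital_direction[OF fc o] by blast
    then show thesis using fc f H
      by (intro that[of "inv f"]) (auto simp: less_E_inv_iff intro: subgroup.m_inv_closed)
  qed
qed

text \<open>The iterates of \<open>x\<close> under a right mover increase; if \<open>y\<close>
  bounded them, their limit would be a fixed point inside the orbital.\<close>

lemma push_right:
  assumes H: "subgroup H G" and f: "f \<in> H" and o: "orbital (E f) a b"
    and x: "a < x" "x < b" and y: "y < b"
  obtains k where "k \<in> H" "\<And>z. E f z = z \<Longrightarrow> E k z = z" "y < E k x"
proof -
  obtain g where g: "g \<in> H" "\<And>x. E g x = x \<longleftrightarrow> E f x = x" "\<And>x. a < x \<Longrightarrow> x < b \<Longrightarrow> x < E g x"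
    using orbital_right_mover[OF H f o] by blast
  have gc: "g \<in> carrier G" using H g(1) by (rule subgroup.mem_carrier)
  have og: "orbital (E g) a b" using o g(2) by (simp add: orbital_def)
  define X where "X n = (E g ^^ n) x" for n
  have X: "a < X n" "X n < b" for n
    by (induction n) (use x orbital_moves[OF gc og] in \<open>auto simp: X_def\<close>)
  have inc: "incseq X"
    using g(3)[OF X] by (intro incseq_SucI) (auto simp: X_def less_imp_le)
  have "\<exists>n. y < X n"
  proof (rule ccontr)
    assume "\<not> ?thesis"
    then have bd: "\<forall>n. X n \<le> y" by (auto simp: not_less)
    obtain l where l: "X \<longlonglongrightarrow> l" "\<forall>n. X n \<le> l"
      using incseq_convergent[OF inc, of y] bd by blast
    have "l \<le> y" using LIMSEQ_le_const2[OF l(1)] bd by blast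
    then have lab: "a < l" "l < b" using l(2) X(1)[of 0] y by (auto intro: less_le_trans)
    have "isCont (E g) l" using E_continuous[OF gc] by (simp add: continuous_on_eq_continuous_at)
    then have "(\<lambda>n. E g (X n)) \<longlonglongrightarrow> E g l" using l(1) by (rule isCont_tendsto_compose)
    then have "(\<lambda>n. X (Suc n)) \<longlonglongrightarrow> E g l" by (simp add: X_def)
    then have "E g l = l" using l(1) LIMSEQ_Suc LIMSEQ_unique by blast
    then show False using g(3)[OF lab] by simp
  qed
  then obtain n where n: "y < X n" by blast
  have ex: "\<exists>k\<in>H. \<forall>z. E k z = (E g ^^ m) z" for m
  proof (induction m)
    case 0
    then show ?case using subgroup.one_closed[OF H] by (intro bexI[of _ \<one>]) auto
  next
    case (Suc m)
    then obtain k where "k \<in> H" "\<forall>z. E k z = (E g ^^ m) z" by blast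
    then show ?case using g(1) gc H
      by (intro bexI[of _ "k \<otimes> g"]) (auto simp: E_mult subgroup.m_closed subgroup.mem_carrier)
  qed
  obtain k where k: "k \<in> H" "\<forall>z. E k z = (E g ^^ n) z" using ex by blast
  have "(E g ^^ n) z = z" if "E g z = z" for z
    using that by (induction n) auto
  then show thesis using k n g(2) by (intro that[of k]) (auto simp: X_def)
qed

section \<open>Germs at fixed points\<close>

lemma fixed_right_germ:
  assumes f: "f \<in> carrier G" and a: "E f a = a"
  obtains m where "eventually (\<lambda>x. E f x = a + m * (x - a)) (at_right a)"
proof -
  obtain m c where mc: "eventually (\<lambda>x. E f x = m * x + c) (at_right a)"
    using E_right[OF f] by blast
  have "isCont (E f) a" using E_continuous[OF f] by (simp add: continuous_on_eq_continuous_at)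
  then have "(E f \<longlongrightarrow> E f a) (at_right a)"
    by (simp add: continuous_at filterlim_at_split)
  then have "((\<lambda>x. m * x + c) \<longlongrightarrow> E f a) (at_right a)"
    using tendsto_cong[OF mc] by simp
  moreover have "((\<lambda>x. m * x + c) \<longlongrightarrow> m * a + c) (at_right a)"
    by (intro tendsto_intros)
  \<comment> \<open>Continuity makes the affine germ take the value \<open>a\<close> at
    \<open>a\<close>, so only the slope remains free.\<close>
  ultimately have "m * a + c = a" using a tendsto_unique[of "at_right a"] by force
  then have "c = a - m * a" by simp
  with mc show thesis by (intro that[of m]) (auto elim!: eventually_mono simp: algebra_simps)
qed

text \<open>A slope other than 1 leaves no fixed point just to the right of \<open>a\<close>, so the
  orbital through a nearby point must begin at \<open>a\<close>.\<close>

lemma right_germ_cases: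
  assumes f: "f \<in> carrier G" and a: "E f a = a"
  shows "eventually (\<lambda>x. E f x = x) (at_right a) \<or> (\<exists>b. orbital (E f) a b)"
proof -
  obtain m where m: "eventually (\<lambda>x. E f x = a + m * (x - a)) (at_right a)"
    using fixed_right_germ[OF f a] .
  show ?thesis
  proof (cases "m = 1")
    case True
    then show ?thesis using m by simp
  next
    case False
    obtain e where e: "e > a" "\<And>x. a < x \<Longrightarrow> x < e \<Longrightarrow> E f x = a + m * (x - a)"
      using m by (auto simp: eventually_at_right_field)
    have move: "E f x \<noteq> x" if "a < x" "x < e" for x
    proof
      assume "E f x = x"
      then have "(m - 1) * (x - a) = 0" using e(2)[OF that] by (simp add: algebra_simps)
      then show False using that False by simp
    qed
    obtain x where x: "a < x" "x < e" using dense[OF e(1)] by blast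
    obtain p q where pq: "p < x" "x < q" "orbital (E f) p q" using ex_orbital[OF f move[OF x]] by blast
    then have "p = a" using a x move by (metis orbital_def linorder_neqE_linordered_idom order.strict_trans)
    then show ?thesis using pq by blast
  qed
qed

text \<open>Just to the right of a common fixed point both maps are scalings about it, and scalings
  about one centre commute.\<close>

lemma right_germs_commute:
  assumes f: "f \<in> carrier G" and g: "g \<in> carrier G" and fa: "E f a = a" and ga: "E g a = a"
  shows "eventually (\<lambda>x. E f (E g x) = E g (E f x)) (at_right a)"
proof -
  obtain m where m: "eventually (\<lambda>x. E f x = a + m * (x - a)) (at_right a)"
    using fixed_right_germ[OF f fa] .
  obtain n where n: "eventually (\<lambda>x. E g x = a + n * (x - a)) (at_right a)"
    using fixed_right_germ[OF g ga] .
  \<comment> \<open>Points close to \<open>a\<close> on its right stay there under either map, so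
    the germ of one may be evaluated at values of the other.\<close>
  have lim: "filterlim (E h) (at_right a) (at_right a)" if h: "h \<in> carrier G" "E h a = a" for h
  proof -
    have "isCont (E h) a" using E_continuous[OF h(1)] by (simp add: continuous_on_eq_continuous_at)
    then have "(E h \<longlongrightarrow> a) (at_right a)"
      using h(2) by (simp add: continuous_at filterlim_at_split)
    moreover have "a < E h x \<and> E h x \<noteq> a" if "a < x" for x
      using E_less[OF h(1), of a x] h(2) that by simp
    then have "eventually (\<lambda>x. a < E h x \<and> E h x \<noteq> a) (at_right a)"
      unfolding eventually_at_filter by (intro always_eventually) simp
    ultimately show ?thesis by (simp add: filterlim_at)
  qed
  have "eventually (\<lambda>x. E f (E g x) = a + m * (E g x - a)) (at_right a)"
    by (rule eventually_compose_filterlim[OF m lim[OF g ga]])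
  moreover have "eventually (\<lambda>x. E g (E f x) = a + n * (E f x - a)) (at_right a)"
    by (rule eventually_compose_filterlim[OF n lim[OF f fa]])
  ultimately show ?thesis using m n
  proof eventually_elim
    case (elim x)
    have "E f (E g x) = a + m * (n * (x - a))" unfolding elim(1) unfolding elim(4) by simp
    moreover have "E g (E f x) = a + n * (m * (x - a))" unfolding elim(2) unfolding elim(3) by simp
    ultimately show ?case by simp
  qed
qed

lemma commutator_right_germ:
  assumes "f \<in> carrier G" "g \<in> carrier G" "E f a = a" "E g a = a"
  shows "eventually (\<lambda>x. E (f \<otimes> g \<otimes> inv f \<otimes> inv g) x = x) (at_right a)"
  using right_germs_commute[OF assms]
proof eventually_elim
  case (elim x)
  then have "E (inv f) (E g (E f x)) = E g x" using assms by (metis E_inv(1))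
  then show ?case using assms by (simp add: E_mult)
qed

end

section \<open>Towers and derived subgroups\<close>

text \<open>Written as \<open>inv f\<close> times a conjugate of \<open>f\<close>, so that its
  effect follows from where \<open>w\<close> carries the orbitals of \<open>f\<close>. In the
  convention of \<open>derived_set\<close> it is the commutator of the inverses, as
  \<open>commut_eq\<close> records.\<close>

definition (in group) commut :: "'a \<Rightarrow> 'a \<Rightarrow> 'a" where
  "commut f w = inv f \<otimes> (inv w \<otimes> f \<otimes> w)"

lemma (in group) commut_closed [simp]: "f \<in> carrier G \<Longrightarrow> w \<in> carrier G \<Longrightarrow> commut f w \<in> carrier G"
  by (simp add: commut_def)

lemma (in group) commut_eq:
  assumes "f \<in> carrier G" "w \<in> carrier G"
  shows "commut f w = inv f \<otimes> inv w \<otimes> inv (inv f) \<otimes> inv (inv w)"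
  using assms by (simp add: commut_def m_assoc)

lemma (in group) commut_in_derived:
  assumes "subgroup H G" "f \<in> H" "w \<in> H"
  shows "commut f w \<in> derived G H"
proof -
  have "inv f \<in> H" "inv w \<in> H" "f \<in> carrier G" "w \<in> carrier G"
    using assms by (auto intro: subgroup.m_inv_closed subgroup.mem_carrier)
  then have "commut f w \<in> derived_set G H" by (simp only: commut_eq) blast
  then show ?thesis unfolding derived_def by (rule generate.incl)
qed

lemma (in group) conj_closed:
  assumes "subgroup H G" "f \<in> H" "w \<in> H"
  shows "inv w \<otimes> f \<otimes> w \<in> H"
  using assms by (intro subgroup.m_closed subgroup.m_inv_closed)

text \<open>The conjugate equals \<open>f\<close> times \<open>commut f w\<close>, a product of two
  elements of the derived subgroup.\<close>

lemma (in group) conj_in_derived: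
  assumes H: "subgroup H G" and f: "f \<in> derived G H" and w: "w \<in> H"
  shows "inv w \<otimes> f \<otimes> w \<in> derived G H"
proof -
  have D: "subgroup (derived G H) G" using derived_is_subgroup[OF subgroup.subset[OF H]] .
  have fH: "f \<in> H" using derived_incl[OF _ H] f by blast
  have c: "f \<in> carrier G" "w \<in> carrier G" using fH w H by (auto intro: subgroup.mem_carrier)
  have "f \<otimes> commut f w \<in> derived G H"
    using commut_in_derived[OF H fH w] f D by (intro subgroup.m_closed)
  moreover have "f \<otimes> commut f w = inv w \<otimes> f \<otimes> w"
    using c by (simp add: commut_def flip: m_assoc)
  ultimately show ?thesis by simp
qed

context pl_action
begin

lemma E_commut:
  "f \<in> carrier G \<Longrightarrow> w \<in> carrier G \<Longrightarrow> E (commut f w) x = E w (E f (E (inv w) (E (inv f) x)))"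
  by (simp add: commut_def E_mult)

lemma commut_right_germ:
  assumes "f \<in> carrier G" "w \<in> carrier G" "E f a = a" "E w a = a"
  shows "eventually (\<lambda>x. E (commut f w) x = x) (at_right a)"
  using assms commutator_right_germ[of "inv f" "inv w" a] by (simp add: commut_eq)

lemma commut_left_germ:
  assumes "f \<in> carrier G" "w \<in> carrier G" "E f b = b" "E w b = b"
  shows "eventually (\<lambda>x. E (commut f w) x = x) (at_left b)"
proof -
  interpret M: pl_action G "mirror E" by (rule pl_action_mirror)
  have "eventually (\<lambda>x. mirror E (commut f w) x = x) (at_right (- b))"
    using assms by (intro M.commut_right_germ) (simp_all add: mirror_def)
  then show ?thesis
    by (simp add: at_right_minus eventually_filtermap mirror_def)
qed

text \<open>Points just to the right of \<open>a\<close> would be both fixed and interior. This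
  keeps orbitals of commutators away from common fixed points of their entries.\<close>

lemma right_germ_orbital:
  assumes "eventually (\<lambda>x. E f x = x) (at_right a)" "orbital (E f) p q" "p \<le> a" "a < q"
  shows False
proof -
  obtain e where e: "a < e" "\<And>x. a < x \<Longrightarrow> x < e \<Longrightarrow> E f x = x"
    using assms(1) by (auto simp: eventually_at_right_field)
  obtain x where "a < x" "x < min e q" using dense[of a "min e q"] e assms by auto
  then show False using assms e by (force simp: orbital_def)
qed

lemma left_germ_orbital:
  assumes "eventually (\<lambda>x. E f x = x) (at_left b)" "orbital (E f) p q" "p < b" "b \<le> q"
  shows False
proof -
  obtain e where e: "e < b" "\<And>x. e < x \<Longrightarrow> x < b \<Longrightarrow> E f x = x"
    using assms(1) by (auto simp: eventually_at_left_field)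
  obtain x where "max e p < x" "x < b" using dense[of "max e p" b] e assms by auto
  then show False using assms e by (force simp: orbital_def)
qed

text \<open>Among the orbitals of two given elements only finitely many chains occur. In a chain with
  largest possible right end \<open>d\<close> the first element must fix \<open>d\<close>.\<close>

lemma chain_imp_right_overlap:
  assumes H: "subgroup H G" and ch: "has_chain E H"
  shows "has_right_overlap E H"
proof -
  obtain g h where gh: "g \<in> H" "h \<in> H" and
    ex: "\<exists>a b c d. orbital (E g) a b \<and> orbital (E h) c d \<and> a < c \<and> c < b \<and> b < d"
    using ch unfolding has_chain_def by blast
  \<comment> \<open>Both roles range over \<open>g\<close> and \<open>h\<close>: the longer chain
    found below has the two elements in the opposite order.\<close>
  define D where "D = {d. \<exists>u\<in>{g, h}. \<exists>v\<in>{g, h}. \<exists>a b c.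
    orbital (E u) a b \<and> orbital (E v) c d \<and> a < c \<and> c < b \<and> b < d}"
  have carr: "u \<in> carrier G" if "u \<in> {g, h}" for u
    using that gh subgroup.mem_carrier[OF H] by auto
  have "D \<subseteq> snd ` ({(a, b). orbital (E g) a b} \<union> {(a, b). orbital (E h) a b})"
    unfolding D_def by (force simp: image_iff)
  then have fin: "finite D"
    by (rule finite_subset) (use E_finite carr in auto)
  have "D \<noteq> {}" using ex unfolding D_def by blast
  then have "Max D \<in> D" using fin by simp
  then obtain u v a b c where uv: "u \<in> {g, h}" "v \<in> {g, h}" and o: "orbital (E u) a b"
    "orbital (E v) c (Max D)" and lt: "a < c" "c < b" "b < Max D"
    unfolding D_def by blast
  have uH: "u \<in> H" and vH: "v \<in> H" using uv gh by auto
  have fix_d: "E u (Max D) = Max D"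
  proof (rule ccontr)
    assume "E u (Max D) \<noteq> Max D"
    then obtain d1 d2 where d: "d1 < Max D" "Max D < d2" "orbital (E u) d1 d2"
      using ex_orbital carr[OF uv(1)] by blast
    have "\<not> d1 < b" using orbitals_meet_eq(2)[OF o(1) d(3)] d lt by auto
    then have "d2 \<in> D" unfolding D_def using uv o d lt by fastforce
    then show False using Max_ge[OF fin] d(2) by fastforce
  qed
  obtain w where w: "w \<in> H" "\<And>x. E w x = x \<longleftrightarrow> E u x = x" "\<And>x. a < x \<Longrightarrow> x < b \<Longrightarrow> x < E w x"
    using orbital_right_mover[OF H uH o(1)] by blast
  \<comment> \<open>\<open>w\<close> fixes the right end because \<open>u\<close> does, but moves
    \<open>c\<close> strictly to the right.\<close>
  have "orbital (E (inv w \<otimes> v \<otimes> w)) (E w c) (E w (Max D))"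
    using o(2) w(1) vH subgroup.mem_carrier[OF H] by (intro orbital_conj) auto
  then have "orbital (E (inv w \<otimes> v \<otimes> w)) (E w c) (Max D)"
    using iffD2[OF w(2) fix_d] by simp
  then show ?thesis
    unfolding has_right_overlap_def using w(3)[OF lt(1,2)] o(2) vH conj_closed[OF H vH w(1)] by blast
qed

text \<open>Repeated conjugation by \<open>w\<close> repeats the inclusion. Only this conjugation
  has to preserve \<open>K\<close>, so \<open>K\<close> may be a derived subgroup with
  \<open>w\<close> taken from the larger group.\<close>

lemma nested_translate_imp_tower:
  assumes K: "K \<subseteq> carrier G" and w: "w \<in> carrier G"
    and cl: "\<And>k. k \<in> K \<Longrightarrow> inv w \<otimes> k \<otimes> w \<in> K"
    and f: "f \<in> K" "orbital (E f) p q"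
    and nest: "p \<le> E w p" "E w q \<le> q" "p < E w p \<or> E w q < q"
  shows "has_tower E K"
proof -
  define F where "F n = ((\<lambda>k. inv w \<otimes> k \<otimes> w) ^^ n) f" for n
  define a where "a n = (E w ^^ n) p" for n
  define b where "b n = (E w ^^ n) q" for n
  have "F n \<in> K \<and> orbital (E (F n)) (a n) (b n) \<and>
     a n \<le> a (Suc n) \<and> b (Suc n) \<le> b n \<and> (a n < a (Suc n) \<or> b (Suc n) < b n)" for n
  proof (induction n)
    case 0
    then show ?case using f nest by (simp add: F_def a_def b_def)
  next
    case (Suc n)
    then show ?case using cl w K orbital_conj[of "F n" w "a n" "b n"] by (auto simp: F_def a_def b_def)
  qed
  then show ?thesis unfolding has_tower_def by blast
qed

text \<open>Conjugating by the inverse of a right mover on \<open>(a, b)\<close> shrinks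
  \<open>(a, c)\<close> and keeps its left end, which gives a strictly nested translate.\<close>

lemma left_overlap_imp_tower:
  assumes H: "subgroup H G" and ov: "has_left_overlap E H"
  shows "has_tower E H"
proof -
  obtain g h a b c where gh: "g \<in> H" "h \<in> H" and o: "orbital (E g) a b" "orbital (E h) a c" "c < b"
    using ov unfolding has_left_overlap_def by blast
  obtain w where w: "w \<in> H" "\<And>x. E w x = x \<longleftrightarrow> E g x = x" "\<And>x. a < x \<Longrightarrow> x < b \<Longrightarrow> x < E w x"
    using orbital_right_mover[OF H gh(1) o(1)] by blast
  have wc: "w \<in> carrier G" using w(1) H by (auto intro: subgroup.mem_carrier)
  have fa: "E w a = a" using w(2) o(1) by (auto simp: orbital_def)
  have ifa: "a \<le> E (inv w) a" using fa wc by (metis E_inv(1) order_refl)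
  have "c < E w c" using w(3) o by (auto simp: orbital_def)
  show ?thesis
  proof (rule nested_translate_imp_tower[where w = "inv w" and f = h and p = a and q = c])
    show "H \<subseteq> carrier G" using H by (rule subgroup.subset)
    show "\<And>k. k \<in> H \<Longrightarrow> inv (inv w) \<otimes> k \<otimes> inv w \<in> H"
      using conj_closed[OF H _ subgroup.m_inv_closed[OF H w(1)]] by blast
  qed (use wc ifa \<open>c < E w c\<close> gh o in \<open>auto simp: E_inv_less_iff intro: less_imp_le\<close>)
qed

lemma overlap_imp_tower:
  assumes H: "subgroup H G" and ov: "has_left_overlap E H \<or> has_right_overlap E H"
  shows "has_tower E H"
proof -
  interpret M: pl_action G "mirror E" by (rule pl_action_mirror)
  show ?thesis using ov left_overlap_imp_tower[OF H] M.left_overlap_imp_tower[OF H] by auto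
qed

text \<open>If \<open>h\<close> moved \<open>a\<close>, its orbital there would end inside
  \<open>(a, b)\<close> and form a chain with it; if its right germ at \<open>a\<close> were
  nontrivial, an orbital of \<open>h\<close> would begin at \<open>a\<close> and form a left
  overlap.\<close>

lemma inner_left:
  assumes H: "subgroup H G" and nch: "\<not> has_chain E H" and nov: "\<not> has_left_overlap E H"
    and gh: "g \<in> H" "h \<in> H" and o: "orbital (E g) a b" "orbital (E h) p q"
    and nest: "a \<le> p" "q \<le> b" "a < p \<or> q < b"
  shows "E h a = a" "eventually (\<lambda>x. E h x = x) (at_right a)" "a < p"
proof -
  have hc: "h \<in> carrier G" using gh(2) H by (auto intro: subgroup.mem_carrier)
  have pq: "p < q" using o(2) by (simp add: orbital_def)
  show fa: "E h a = a"
  proof (rule ccontr)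
    assume "E h a \<noteq> a"
    then obtain u v where uv: "u < a" "a < v" "orbital (E h) u v" using ex_orbital hc by blast
    have "\<not> p < v" using orbitals_meet_eq(1)[OF uv(3) o(2)] uv nest pq by linarith
    then have "u < a \<and> a < v \<and> v < b" using uv pq nest by auto
    then show False using nch gh o(1) uv(3) unfolding has_chain_def by blast
  qed
  have no_orb: "\<not> orbital (E h) a v" for v
  proof
    assume v: "orbital (E h) a v"
    then have "a < v" by (simp add: orbital_def)
    have "v < b"
    proof (cases "p < v")
      case True
      then show ?thesis using orbitals_meet_eq[OF v o(2)] nest pq by auto
    qed (use pq nest in auto)
    then show False using nov gh o(1) v unfolding has_left_overlap_def by blast
  qed
  then show "eventually (\<lambda>x. E h x = x) (at_right a)" using right_germ_cases[OF hc fa] by blast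
  show "a < p" using no_orb o(2) nest(1) by (cases "a = p") auto
qed

lemma inner_right:
  assumes H: "subgroup H G" and nch: "\<not> has_chain E H" and nov: "\<not> has_right_overlap E H"
    and gh: "g \<in> H" "h \<in> H" and o: "orbital (E g) a b" "orbital (E h) p q"
    and nest: "a \<le> p" "q \<le> b" "a < p \<or> q < b"
  shows "E h b = b" "eventually (\<lambda>x. E h x = x) (at_left b)" "q < b"
proof -
  interpret M: pl_action G "mirror E" by (rule pl_action_mirror)
  have *: "mirror E h (- b) = - b" "eventually (\<lambda>x. mirror E h x = x) (at_right (- b))" "- b < - q"
    using M.inner_left[OF H _ _ gh, of "- b" "- a" "- q" "- p"] nch nov o nest by auto
  show "E h b = b" "q < b" using * by (auto simp: mirror_def)
  show "eventually (\<lambda>x. E h x = x) (at_left b)"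
    using *(2) by (simp add: at_right_minus eventually_filtermap mirror_def)
qed

text \<open>A large power of \<open>g\<close> pushes the support of \<open>h\<close> inside \<open>(a, b)\<close> off itself, so that the
  commutator agrees with \<open>h\<inverse>\<close> on \<open>[p, q]\<close>.\<close>

lemma nested_orbital_in_derived:
  assumes H: "subgroup H G" and nch: "\<not> has_chain E H"
    and nov: "\<not> has_left_overlap E H" "\<not> has_right_overlap E H"
    and gh: "g \<in> H" "h \<in> H" and o: "orbital (E g) a b" "orbital (E h) p q"
    and nest: "a \<le> p" "q \<le> b" "a < p \<or> q < b"
  shows "\<exists>f\<in>derived G H. orbital (E f) p q"
proof -
  note L = inner_left[OF H nch nov(1) gh o nest] and R = inner_right[OF H nch nov(2) gh o nest]
  have hc: "h \<in> carrier G" using gh(2) H by (auto intro: subgroup.mem_carrier)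
  have pq: "p < q" using o(2) by (simp add: orbital_def)
  obtain s where s: "a < s" "\<And>x. a < x \<Longrightarrow> x < s \<Longrightarrow> E h x = x"
    using L(2) by (auto simp: eventually_at_right_field)
  obtain t where t: "t < b" "\<And>x. t < x \<Longrightarrow> x < b \<Longrightarrow> E h x = x"
    using R(2) by (auto simp: eventually_at_left_field)
  obtain s' where s': "a < s'" "s' < min s b" using dense[of a "min s b"] s(1) o(1) by (auto simp: orbital_def)
  obtain k where k: "k \<in> H" "\<And>z. E g z = z \<Longrightarrow> E k z = z" "max t q < E k s'"
    using push_right[OF H gh(1) o(1), of s' "max t q"] s' t R(3) by auto
  have kc: "k \<in> carrier G" using k(1) H by (auto intro: subgroup.mem_carrier)
  have ka: "E k a = a" using k(2) o(1) by (auto simp: orbital_def)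
  have agree: "E (commut h k) x = E (inv h) x" if x: "p \<le> x" "x \<le> q" for x
  proof -
    define y where "y = E (inv h) x"
    have "p \<le> y" "y \<le> q"
      using x o(2) hc E_le[OF hc, of p "E (inv h) x"] E_le[OF hc, of "E (inv h) x" q]
      by (simp_all add: y_def orbital_def)
    \<comment> \<open>\<open>k\<close> carries \<open>s'\<close> beyond \<open>q\<close>, hence its
      inverse takes \<open>[p, q]\<close> into \<open>(a, s)\<close>, where \<open>h\<close> is the
      identity.\<close>
    have "E k s' < E k s" using s' kc by simp
    then have "E k a < y" "y < E k s" using \<open>p \<le> y\<close> \<open>y \<le> q\<close> ka L(3) k(3) by linarith+
    then have "a < E (inv k) y" "E (inv k) y < s"
      by (simp_all only: E_inv_less_iff[OF kc] less_E_inv_iff[OF kc])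
    then have "E h (E (inv k) y) = E (inv k) y" using s by blast
    then show ?thesis using hc kc by (simp add: E_commut y_def)
  qed
  have "orbital (E (commut h k)) p q"
    using agree o(2) hc orbital_inv[OF hc, of p q] pq unfolding orbital_def by auto
  then show ?thesis using commut_in_derived[OF H gh(2) k(1)] by blast
qed

text \<open>Every orbital of the tower but the outermost is strictly enclosed by its predecessor and
  so survives; this is the index shift.\<close>

lemma tower_in_derived_if_no_overlap:
  assumes H: "subgroup H G" and nov: "\<not> has_left_overlap E H" "\<not> has_right_overlap E H"
    and tw: "has_tower E H"
  shows "has_tower E (derived G H)"
proof -
  have nch: "\<not> has_chain E H" using chain_imp_right_overlap[OF H] nov by blast
  obtain g a b where T: "\<And>i::nat. g i \<in> H" "\<And>i. orbital (E (g i)) (a i) (b i)"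
     "\<And>i. a i \<le> a (Suc i)" "\<And>i. b (Suc i) \<le> b i" "\<And>i. a i < a (Suc i) \<or> b (Suc i) < b i"
    using tw unfolding has_tower_def by blast
  have "\<forall>i. \<exists>f. f \<in> derived G H \<and> orbital (E f) (a (Suc i)) (b (Suc i))"
    using nested_orbital_in_derived[OF H nch nov T(1,1,2,2,3,4,5)] by blast
  then obtain F where "\<And>i. F i \<in> derived G H" "\<And>i. orbital (E (F i)) (a (Suc i)) (b (Suc i))"
    by metis
  then show ?thesis
    unfolding has_tower_def using T(3-5)
    by (intro exI[of _ F] exI[of _ "\<lambda>i. a (Suc i)"] exI[of _ "\<lambda>i. b (Suc i)"]) blast
qed

text \<open>By normality the translate is again an orbital of the derived subgroup. If both ends
  move the same way there is a chain, hence an overlap and a tower; strict nesting in either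
  direction gives a tower through \<open>w\<close> or its inverse.\<close>

lemma translates_disjoint_if_no_tower:
  assumes H: "subgroup H G" and nt: "\<not> has_tower E (derived G H)"
    and f: "f \<in> derived G H" "orbital (E f) p q" and w: "w \<in> H"
    and meet: "E w p < q" "p < E w q"
  shows "E w p = p" "E w q = q"
proof -
  have wc: "w \<in> carrier G" using w H by (auto intro: subgroup.mem_carrier)
  have D: "subgroup (derived G H) G" using derived_is_subgroup[OF subgroup.subset[OF H]] .
  have Dc: "derived G H \<subseteq> carrier G" using D by (rule subgroup.subset)
  have nch: "\<not> has_chain E (derived G H)"
    using chain_imp_right_overlap[OF D] overlap_imp_tower[OF D] nt by blast
  have f': "inv w \<otimes> f \<otimes> w \<in> derived G H" using conj_in_derived[OF H f(1) w] .
  have o': "orbital (E (inv w \<otimes> f \<otimes> w)) (E w p) (E w q)"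
    using f Dc wc by (intro orbital_conj) auto
  have "\<not> (p < E w p \<and> q < E w q)" "\<not> (E w p < p \<and> E w q < q)"
    using nch f f' o' meet unfolding has_chain_def by blast+
  moreover have "\<not> (p \<le> E w p \<and> E w q \<le> q \<and> (p < E w p \<or> E w q < q))"
    using nested_translate_imp_tower[OF Dc wc _ f] conj_in_derived[OF H _ w] nt by blast
  moreover have "\<not> (E w p \<le> p \<and> q \<le> E w q \<and> (E w p < p \<or> q < E w q))"
    using nested_translate_imp_tower[OF Dc _ _ f, of "inv w"] nt wc
      conj_in_derived[OF H _ subgroup.m_inv_closed[OF H w]]
    by (simp add: E_inv_less_iff less_E_inv_iff not_less [symmetric]) (metis not_less)
  ultimately show "E w p = p" "E w q = q" by linarith+
qed

text \<open>If \<open>g\<close>, \<open>h\<close> have orbitals \<open>(a, b)\<close>, \<open>(a, c)\<close> and \<open>k\<close> is a conjugate of \<open>h\<close> by a power of \<open>g\<close>, with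
  orbital reaching beyond \<open>c\<close>, then \<open>h\<inverse>k\<close> and \<open>k\<close> have the same effect on \<open>c\<close>. The orbital of \<open>h\<inverse>k\<close>
  around \<open>c\<close> therefore meets its image under \<open>k\<close>, so without a tower it contains \<open>(a, c)\<close>, although
  \<open>h\<inverse>k\<close> has trivial germ at \<open>a\<close>.\<close>

lemma left_overlap_imp_tower_in_derived:
  assumes H: "subgroup H G" and ov: "has_left_overlap E H"
  shows "has_tower E (derived G H)"
proof (rule ccontr)
  assume nt: "\<not> has_tower E (derived G H)"
  obtain g h a b c where gh: "g \<in> H" "h \<in> H" and o: "orbital (E g) a b" "orbital (E h) a c" "c < b"
    using ov unfolding has_left_overlap_def by blast
  obtain w where w: "w \<in> H" "\<And>x. E w x = x \<longleftrightarrow> E g x = x" "\<And>x. a < x \<Longrightarrow> x < b \<Longrightarrow> x < E w x"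
    using orbital_right_mover[OF H gh(1) o(1)] by blast
  have wc: "w \<in> carrier G" and hc: "h \<in> carrier G" using w(1) gh H by (auto intro: subgroup.mem_carrier)
  have fa: "E w a = a" "E h a = a" and hcc: "E h c = c" and ac: "a < c"
    using w(2) o by (auto simp: orbital_def)
  have cw: "c < E w c" using w(3) o by (auto simp: orbital_def)
  define k where "k = inv w \<otimes> h \<otimes> w"
  have kH: "k \<in> H" unfolding k_def using conj_closed[OF H gh(2) w(1)] .
  have kc: "k \<in> carrier G" using kH H by (auto intro: subgroup.mem_carrier)
  have ok: "orbital (E k) a (E w c)" using orbital_conj[OF hc wc o(2)] fa by (simp add: k_def)
  define f where "f = commut h w"
  have fD: "f \<in> derived G H" unfolding f_def using commut_in_derived[OF H gh(2) w(1)] .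
  have fc: "f \<in> carrier G" unfolding f_def using hc wc by simp
  have Efc: "E f c = E k c"
    using hc wc hcc E_inv_fix_iff[OF hc, of c] by (simp add: f_def k_def E_commut E_conj)
  have "E f c \<noteq> c" using ok ac cw Efc by (auto simp: orbital_def)
  then obtain p q where pq: "p < c" "c < q" "orbital (E f) p q" using ex_orbital[OF fc] by blast
  have meet: "E k p < q" "p < E k q"
    using orbital_moves[OF fc pq(3,1,2)] Efc pq kc by (metis E_less less_trans)+
  note fix_k = translates_disjoint_if_no_tower[OF H nt fD pq(3) kH meet]
  \<comment> \<open>\<open>k\<close> fixes \<open>p\<close>, yet moves every point of
    \<open>(a, E w c)\<close>.\<close>
  have "p \<le> a" using fix_k(1) ok pq cw by (force simp: orbital_def not_less [symmetric])
  then show False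
    using right_germ_orbital[OF commut_right_germ[OF hc wc fa(2,1)] pq(3)[unfolded f_def]] ac pq by simp
qed

text \<open>An overlap on either side already forces a tower in the derived subgroup; otherwise the
  given tower descends.\<close>

lemma tower_imp_tower_in_derived:
  assumes H: "subgroup H G" and tw: "has_tower E H"
  shows "has_tower E (derived G H)"
proof -
  interpret M: pl_action G "mirror E" by (rule pl_action_mirror)
  show ?thesis
    using left_overlap_imp_tower_in_derived[OF H] M.left_overlap_imp_tower_in_derived[OF H]
      tower_in_derived_if_no_overlap[OF H _ _ tw] by auto
qed

lemma tower_imp_derived_nontrivial:
  assumes H: "subgroup H G" and tw: "has_tower E H"
  shows "(derived G ^^ n) H \<noteq> {\<one>}"
proof
  have "has_tower E ((derived G ^^ n) H)"
    by (induction n) (use tw tower_imp_tower_in_derived exp_of_derived_is_subgroup[OF H] in auto)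
  moreover assume "(derived G ^^ n) H = {\<one>}"
  ultimately obtain a b where ab: "orbital (E \<one>) a b"
    unfolding has_tower_def by (metis singletonD)
  moreover obtain x where "a < x" "x < b" using ab dense unfolding orbital_def by blast
  ultimately show False by (auto simp: orbital_def)
qed

text \<open>For \<open>g\<close>, \<open>h\<close> as above without a chain, \<open>h\<close> fixes \<open>b\<close>. If \<open>k\<close> is a large power of \<open>h\<close>, the orbital of
  the commutator of \<open>k\<close> and \<open>g\<^sup>2\<close> around \<open>c\<close> reaches beyond \<open>cg\<close>, but neither to \<open>a\<close> nor to \<open>b\<close>; it
  forms a chain with its image under \<open>g\<close>.\<close>

lemma left_overlap_imp_chain:
  assumes H: "subgroup H G" and ov: "has_left_overlap E H"
  shows "has_chain E H"
proof (rule ccontr)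
  assume nch: "\<not> has_chain E H"
  obtain g h a b c where gh: "g \<in> H" "h \<in> H" and o: "orbital (E g) a b" "orbital (E h) a c" "c < b"
    using ov unfolding has_left_overlap_def by blast
  obtain w where w: "w \<in> H" "\<And>x. E w x = x \<longleftrightarrow> E g x = x" "\<And>x. a < x \<Longrightarrow> x < b \<Longrightarrow> x < E w x"
    using orbital_right_mover[OF H gh(1) o(1)] by blast
  have wc: "w \<in> carrier G" and hc: "h \<in> carrier G" using w(1) gh H by (auto intro: subgroup.mem_carrier)
  have fw: "E w a = a" "E w b = b" and hac: "E h a = a" "E h c = c" and ac: "a < c"
    using w(2) o by (auto simp: orbital_def)
  have hb: "E h b = b"
  proof (rule ccontr)
    assume "E h b \<noteq> b"
    then obtain u v where uv: "u < b" "b < v" "orbital (E h) u v" using ex_orbital hc by blast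
    have "\<not> u < c" using orbitals_meet_eq(2)[OF o(2) uv(3)] uv ac o(3) by auto
    then have "a < u" using ac by simp
    then show False using nch gh o(1) uv unfolding has_chain_def by blast
  qed
  have ow: "orbital (E w) a b" using o(1) w(2) by (simp add: orbital_def)
  have cw: "c < E w c" "E w c < b" using w(3)[OF ac o(3)] orbital_moves(2)[OF wc ow ac o(3)] by simp_all
  \<comment> \<open>Two steps back are needed: \<open>k\<close> takes \<open>c2\<close> past
    \<open>c1\<close>, and two applications of \<open>w\<close> take \<open>c1\<close> to
    \<open>E w c\<close>. So the commutator moves \<open>c\<close> past \<open>E w c\<close>, enough
    for its orbital to meet its translate by \<open>w\<close>.\<close>
  define c1 where "c1 = E (inv w) c"
  define c2 where "c2 = E (inv w) c1"
  have c1: "a < c1" "c1 < c" using cw ac fw wc by (auto simp: c1_def E_inv_less_iff less_E_inv_iff)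
  have c2: "a < c2" "c2 < c1" using c1 fw wc by (auto simp: c1_def c2_def E_inv_less_iff less_E_inv_iff)
  obtain k where k: "k \<in> H" "\<And>z. E h z = z \<Longrightarrow> E k z = z" "c1 < E k c2"
    using push_right[OF H gh(2) o(2), of c2 c1] c1 c2 by auto
  have kc: "k \<in> carrier G" using k(1) H by (auto intro: subgroup.mem_carrier)
  define w2 where "w2 = w \<otimes> w"
  have w2: "w2 \<in> H" "w2 \<in> carrier G" using w(1) wc H by (auto simp: w2_def subgroup.m_closed)
  have Ew2: "E w2 x = E w (E w x)" for x using wc by (simp add: w2_def E_mult)
  have iw2: "E (inv w2) c = c2"
    using E_inv_eq_iff[OF w2(2)] wc by (simp add: Ew2 c1_def c2_def)
  define f where "f = commut k w2"
  have fH: "f \<in> H"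
    unfolding f_def commut_def using H k(1) w2(1) by (intro subgroup.m_closed subgroup.m_inv_closed)
  have fc: "f \<in> carrier G" using fH H by (auto intro: subgroup.mem_carrier)
  have kfix: "E (inv k) x = x" if "E h x = x" for x using k(2)[OF that] kc by simp
  have "E f c = E w2 (E k c2)"
    unfolding f_def E_commut[OF kc w2(2)] kfix[OF hac(2)] iw2 ..
  then have fcw: "E w c < E f c"
    using E_less[OF w2(2), of c1 "E k c2"] k(3) wc by (simp add: Ew2 c1_def)
  then obtain p q where pq: "p < c" "c < q" "orbital (E f) p q" using ex_orbital[OF fc] cw by force
  have qw: "E w c < q" using fcw orbital_moves[OF fc pq(3,1,2)] by auto
  have w2fix: "E (inv w2) a = a" "E (inv w2) b = b" using w2(2) fw by (simp_all add: Ew2)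
  have fab: "E f a = a" "E f b = b"
    unfolding f_def E_commut[OF kc w2(2)] kfix[OF hac(1)] kfix[OF hb] w2fix k(2)[OF hac(1)] k(2)[OF hb]
    by (simp_all add: Ew2 fw)
  have "a \<le> p" "q \<le> b" using fab pq ac o(3) by (force simp: orbital_def not_less [symmetric])+
  moreover have "p \<noteq> a"
    using right_germ_orbital[OF commut_right_germ[OF kc w2(2)], of a a q] pq fw k(2) hac ac
    by (auto simp: f_def Ew2)
  moreover have "q \<noteq> b"
    using left_germ_orbital[OF commut_left_germ[OF kc w2(2)], of b p b] pq fw k(2) hb o(3)
    by (auto simp: f_def Ew2)
  ultimately have pqab: "a < p" "q < b" by auto
  have "p < E w p" "q < E w q" "E w p < q" using w(3) pqab pq o(3) ac qw wc
    by (auto intro: less_trans[of _ "E w c"])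
  moreover have "orbital (E (inv w \<otimes> f \<otimes> w)) (E w p) (E w q)" using orbital_conj[OF fc wc pq(3)] .
  ultimately show False
    using nch fH conj_closed[OF H fH w(1)] pq(3) unfolding has_chain_def by blast
qed

lemma overlap_imp_chain:
  assumes H: "subgroup H G" and ov: "has_left_overlap E H \<or> has_right_overlap E H"
  shows "has_chain E H"
proof -
  interpret M: pl_action G "mirror E" by (rule pl_action_mirror)
  show ?thesis using ov left_overlap_imp_chain[OF H] M.left_overlap_imp_chain[OF H] by auto
qed

end

section \<open>Groups without chains\<close>

context pl_action
begin

lemma left_germ_cases:
  assumes f: "f \<in> carrier G" and b: "E f b = b"
  shows "eventually (\<lambda>x. E f x = x) (at_left b) \<or> (\<exists>a. orbital (E f) a b)"
proof -
  interpret M: pl_action G "mirror E" by (rule pl_action_mirror)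
  have "eventually (\<lambda>x. mirror E f x = x) (at_right (- b)) \<or> (\<exists>a. orbital (mirror E f) (- b) a)"
    using M.right_germ_cases[OF f, of "- b"] b by (simp add: mirror_def)
  then show ?thesis
  proof (elim disjE exE)
    assume "eventually (\<lambda>x. mirror E f x = x) (at_right (- b))"
    then have "eventually (\<lambda>x. E f x = x) (at_left b)"
      by (simp add: at_right_minus eventually_filtermap mirror_def)
    then show ?thesis by blast
  next
    fix a assume "orbital (mirror E f) (- b) a"
    then show ?thesis by auto
  qed
qed

text \<open>The orbital of \<open>w\<close> around an end of \<open>(a, b)\<close> that
  \<open>w\<close> moves gives a chain or an overlap, unless it contains both ends. The tower
  generated by a nested translate gives no contradiction at this stage.\<close>

lemma no_nested_translate:
  assumes H: "subgroup H G" and nch: "\<not> has_chain E H"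
    and fw: "f \<in> H" "w \<in> H" and o: "orbital (E f) a b"
    and nest: "a \<le> E w a" "E w b \<le> b" "a < E w a \<or> E w b < b"
  shows False
proof -
  have nov: "\<not> has_left_overlap E H" "\<not> has_right_overlap E H"
    using overlap_imp_chain[OF H] nch by blast+
  have wc: "w \<in> carrier G" using fw(2) H by (auto intro: subgroup.mem_carrier)
  have ab: "a < b" using o by (simp add: orbital_def)
  show False
  proof (cases "a < E w a")
    case True
    then obtain r s where rs: "r < a" "a < s" "orbital (E w) r s" using ex_orbital[OF wc, of a] by auto
    consider "s < b" | "s = b" | "b < s" by linarith
    then show False
    proof cases
      case 1
      then show ?thesis using nch fw o rs unfolding has_chain_def by blast
    next
      case 2
      then show ?thesis using nov(2) fw o rs unfolding has_right_overlap_def by blast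
    next
      case 3
      then have "r < b" using rs ab by simp
      \<comment> \<open>Both ends now lie in one orbital of \<open>w\<close> and move in the same
        direction, against the nesting.\<close>
      then show ?thesis using orbital_direction[OF wc rs(3)] True nest(2) rs(1,2) 3 by force
    qed
  next
    case False
    then have fa: "E w a = a" and wb: "E w b < b" using nest by auto
    then obtain r s where rs: "r < b" "b < s" "orbital (E w) r s" using ex_orbital[OF wc, of b] by auto
    have "\<not> r < a" using rs fa ab by (auto simp: orbital_def)
    then consider "r = a" | "a < r" by linarith
    then show False
    proof cases
      case 1
      then show ?thesis using nov(1) fw o rs unfolding has_left_overlap_def by blast
    next
      case 2
      then show ?thesis using nch fw o rs unfolding has_chain_def by blast
    qed
  qed
qed

text \<open>Meeting intervals that differ are either shifted, which is a chain, or strictly nested;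
  the case of a larger translate is reduced to a smaller one by \<open>inv w\<close>.\<close>

lemma translates_disjoint:
  assumes H: "subgroup H G" and nch: "\<not> has_chain E H"
    and fw: "f \<in> H" "w \<in> H" and o: "orbital (E f) p q"
    and meet: "E w p < q" "p < E w q"
  shows "E w p = p" "E w q = q"
proof -
  have wc: "w \<in> carrier G" and fc: "f \<in> carrier G" using fw H by (auto intro: subgroup.mem_carrier)
  have f': "inv w \<otimes> f \<otimes> w \<in> H" using conj_closed[OF H fw] .
  have o': "orbital (E (inv w \<otimes> f \<otimes> w)) (E w p) (E w q)" using orbital_conj[OF fc wc o] .
  have "\<not> (p < E w p \<and> q < E w q)" "\<not> (E w p < p \<and> E w q < q)"
    using nch fw f' o o' meet unfolding has_chain_def by blast+
  moreover have "\<not> (p \<le> E w p \<and> E w q \<le> q \<and> (p < E w p \<or> E w q < q))"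
    using no_nested_translate[OF H nch fw o] by blast
  moreover have "\<not> (E w p \<le> p \<and> q \<le> E w q \<and> (E w p < p \<or> q < E w q))"
  proof
    assume "E w p \<le> p \<and> q \<le> E w q \<and> (E w p < p \<or> q < E w q)"
    then have "\<not> E (inv w) p < p" "\<not> q < E (inv w) q" "p < E (inv w) p \<or> E (inv w) q < q"
      using wc by (auto simp: E_inv_less_iff less_E_inv_iff)
    then show False
      using no_nested_translate[OF H nch fw(1) subgroup.m_inv_closed[OF H fw(2)] o] by simp
  qed
  ultimately show "E w p = p" "E w q = q" by linarith+
qed

text \<open>Take the longest orbital around \<open>x\<close>. An element of \<open>Y\<close> moving
  one of its ends has an orbital there that either stops inside, giving a chain, or covers the whole
  interval and is longer.\<close>

lemma maximal_orbital:
  assumes H: "subgroup H G" and nch: "\<not> has_chain E H"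
    and Y: "finite Y" "Y \<subseteq> H" and y0: "y0 \<in> Y" "E y0 x \<noteq> x"
  obtains y a b where "y \<in> Y" "orbital (E y) a b" "a < x" "x < b"
    "\<And>u. u \<in> Y \<Longrightarrow> E u a = a" "\<And>u. u \<in> Y \<Longrightarrow> E u b = b"
proof -
  have Yc: "u \<in> carrier G" if "u \<in> Y" for u
    using that Y(2) H by (auto intro: subgroup.mem_carrier)
  define P where "P = {(a, b). \<exists>u\<in>Y. orbital (E u) a b \<and> a < x \<and> x < b}"
  have "P \<subseteq> (\<Union>u\<in>Y. {(a, b). orbital (E u) a b})" unfolding P_def by blast
  then have fin: "finite P"
    by (rule finite_subset) (use Y(1) E_finite Yc in blast)
  have "P \<noteq> {}" unfolding P_def using ex_orbital[OF Yc y0(2)] y0(1) by blast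
  then have "Max ((\<lambda>(a, b). b - a) ` P) \<in> (\<lambda>(a, b). b - a) ` P" using fin by (intro Max_in) auto
  then obtain a b where ab: "(a, b) \<in> P" and mx: "Max ((\<lambda>(a, b). b - a) ` P) = b - a" by auto
  obtain y where y: "y \<in> Y" "orbital (E y) a b" "a < x" "x < b" using ab unfolding P_def by blast
  have le: "d - c \<le> b - a" if "u \<in> Y" "orbital (E u) c d" "c < x" "x < d" for u c d
  proof -
    have "(c, d) \<in> P" using that unfolding P_def by blast
    then have "d - c \<in> (\<lambda>(a, b). b - a) ` P" by force
    then show ?thesis using Max_ge[of "(\<lambda>(a, b). b - a) ` P"] fin mx by auto
  qed
  have "E u a = a" if u: "u \<in> Y" for u
  proof (rule ccontr)
    assume "E u a \<noteq> a"
    then obtain c d where cd: "c < a" "a < d" "orbital (E u) c d" using ex_orbital Yc[OF u] by blast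
    show False
    proof (cases "d < b")
      case True
      then show ?thesis using nch y u cd Y(2) unfolding has_chain_def by blast
    next
      case False
      then show ?thesis using le[OF u cd(3)] cd y by auto
    qed
  qed
  moreover have "E u b = b" if u: "u \<in> Y" for u
  proof (rule ccontr)
    assume "E u b \<noteq> b"
    then obtain c d where cd: "c < b" "b < d" "orbital (E u) c d" using ex_orbital Yc[OF u] by blast
    show False
    proof (cases "a < c")
      case True
      then show ?thesis using nch y u cd Y(2) unfolding has_chain_def by blast
    next
      case False
      then show ?thesis using le[OF u cd(3)] cd y by auto
    qed
  qed
  ultimately show thesis using that y by blast
qed

lemma commutator_left_germ:
  assumes "f \<in> carrier G" "g \<in> carrier G" "E f b = b" "E g b = b"
  shows "eventually (\<lambda>x. E (f \<otimes> g \<otimes> inv f \<otimes> inv g) x = x) (at_left b)"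
  using assms commut_left_germ[of "inv f" "inv g" b] by (simp add: commut_eq)

text \<open>\<open>Y\<close> collects the entries of the finitely many commutators in a word for
  \<open>f\<close>. At a common fixed point of \<open>Y\<close> every factor has trivial germs,
  hence so does the product.\<close>

lemma derived_germs:
  assumes H: "subgroup H G" and f: "f \<in> derived G H"
  shows "\<exists>Y. finite Y \<and> Y \<subseteq> H \<and> (\<forall>z. (\<forall>y\<in>Y. E y z = z) \<longrightarrow> E f z = z \<and>
    eventually (\<lambda>x. E f x = x) (at_right z) \<and> eventually (\<lambda>x. E f x = x) (at_left z))"
    (is "\<exists>Y. ?P Y f")
  using f unfolding derived_def
proof (induction rule: generate.induct)
  case one
  then show ?case by (intro exI[of _ "{}"]) simp
next
  case (incl h)
  then obtain u v where uv: "u \<in> H" "v \<in> H" "h = u \<otimes> v \<otimes> inv u \<otimes> inv v" by blast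
  then have c: "u \<in> carrier G" "v \<in> carrier G" using H by (auto intro: subgroup.mem_carrier)
  have "E h z = z" if "E u z = z" "E v z = z" for z
    unfolding uv(3) using c that by (simp add: E_mult) (metis E_inv(1))
  then have "?P {u, v} h"
    using uv commutator_right_germ[OF c] commutator_left_germ[OF c] by auto
  then show ?case by blast
next
  case (inv h)
  then obtain u v where uv: "u \<in> H" "v \<in> H" "h = u \<otimes> v \<otimes> inv u \<otimes> inv v" by blast
  then have c: "u \<in> carrier G" "v \<in> carrier G" using H by (auto intro: subgroup.mem_carrier)
  then have hc: "h \<in> carrier G" using uv(3) by simp
  have "E h z = z" if "E u z = z" "E v z = z" for z
    unfolding uv(3) using c that by (simp add: E_mult) (metis E_inv(1))
  then have "?P {u, v} (inv h)"
    using uv commutator_right_germ[OF c] commutator_left_germ[OF c] hc by auto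
  then show ?case by blast
next
  case (eng h1 h2)
  obtain Y1 where Y1: "finite Y1" "Y1 \<subseteq> H" and Y1z: "\<And>z. (\<forall>y\<in>Y1. E y z = z) \<Longrightarrow> E h1 z = z \<and>
    eventually (\<lambda>x. E h1 x = x) (at_right z) \<and> eventually (\<lambda>x. E h1 x = x) (at_left z)"
    using eng.IH(1) by blast
  obtain Y2 where Y2: "finite Y2" "Y2 \<subseteq> H" and Y2z: "\<And>z. (\<forall>y\<in>Y2. E y z = z) \<Longrightarrow> E h2 z = z \<and>
    eventually (\<lambda>x. E h2 x = x) (at_right z) \<and> eventually (\<lambda>x. E h2 x = x) (at_left z)"
    using eng.IH(2) by blast
  have c: "h1 \<in> carrier G" "h2 \<in> carrier G"
    using eng(1,2) derived_in_carrier[OF subgroup.subset[OF H]] unfolding derived_def by auto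
  have comp: "eventually (\<lambda>x. E (h1 \<otimes> h2) x = x) F"
    if "eventually (\<lambda>x. E h1 x = x) F" "eventually (\<lambda>x. E h2 x = x) F" for F
    using that by eventually_elim (simp add: E_mult c)
  have "E (h1 \<otimes> h2) z = z \<and> eventually (\<lambda>x. E (h1 \<otimes> h2) x = x) (at_right z) \<and>
    eventually (\<lambda>x. E (h1 \<otimes> h2) x = x) (at_left z)" if z: "\<forall>y\<in>Y1 \<union> Y2. E y z = z" for z
  proof -
    have 1: "E h1 z = z" "eventually (\<lambda>x. E h1 x = x) (at_right z)" "eventually (\<lambda>x. E h1 x = x) (at_left z)"
      using Y1z[of z] z by blast+
    have 2: "E h2 z = z" "eventually (\<lambda>x. E h2 x = x) (at_right z)" "eventually (\<lambda>x. E h2 x = x) (at_left z)"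
      using Y2z[of z] z by blast+
    show ?thesis using comp[OF 1(2) 2(2)] comp[OF 1(3) 2(3)] by (simp add: E_mult[OF c] 1(1) 2(1))
  qed
  note germs = this
  show ?case
  proof (rule exI[of _ "Y1 \<union> Y2"], intro conjI)
    show "finite (Y1 \<union> Y2)" "Y1 \<union> Y2 \<subseteq> H" using Y1 Y2 by auto
  qed (rule allI, rule impI, rule germs)
qed

text \<open>Some element of the finite set \<open>Y\<close> moves a given point of
  \<open>(p, q)\<close>. The largest orbital around that point has ends fixed by all of
  \<open>Y\<close>, where \<open>f\<close> has trivial germs, so the orbital of \<open>f\<close>
  stops strictly before them.\<close>

lemma derived_orbital_enclosed:
  assumes H: "subgroup H G" and nch: "\<not> has_chain E H"
    and f: "f \<in> derived G H" and o: "orbital (E f) p q"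
  shows "\<exists>g\<in>H. \<exists>a b. orbital (E g) a b \<and> a < p \<and> q < b"
proof -
  obtain Y where Y: "finite Y" "Y \<subseteq> H" and Yz: "\<forall>z. (\<forall>y\<in>Y. E y z = z) \<longrightarrow> E f z = z \<and>
    eventually (\<lambda>x. E f x = x) (at_right z) \<and> eventually (\<lambda>x. E f x = x) (at_left z)"
    using derived_germs[OF H f] by (elim exE conjE) (rule that)
  obtain x where x: "p < x" "x < q" using o dense unfolding orbital_def by blast
  then have "E f x \<noteq> x" using o by (auto simp: orbital_def)
  then have "\<not> (\<forall>y\<in>Y. E y x = x)" using Yz by iprover
  then obtain y0 where "y0 \<in> Y" "E y0 x \<noteq> x" by blast
  then obtain y a b where y: "y \<in> Y" "orbital (E y) a b" "a < x" "x < b"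
    "\<And>u. u \<in> Y \<Longrightarrow> E u a = a" "\<And>u. u \<in> Y \<Longrightarrow> E u b = b"
    using maximal_orbital[OF H nch Y(1,2)] by blast
  note a = Yz[rule_format, of a, OF y(5)] and b = Yz[rule_format, of b, OF y(6)]
  have "\<not> p \<le> a" using right_germ_orbital[OF _ o, of a] a x y by auto
  moreover have "\<not> b \<le> q" using left_germ_orbital[OF _ o, of b] b x y by auto
  ultimately show ?thesis using y Y(2) by (meson not_le subsetD)
qed

text \<open>The index counts strict inclusions, so depth \<open>n\<close> means \<open>n + 1\<close>
  orbitals, listed from the outermost inwards.\<close>

primrec nested_orbitals :: "'a set \<Rightarrow> nat \<Rightarrow> real \<Rightarrow> real \<Rightarrow> bool" where
  "nested_orbitals H 0 a b \<longleftrightarrow> (\<exists>g\<in>H. orbital (E g) a b)"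
| "nested_orbitals H (Suc n) a b \<longleftrightarrow> (\<exists>g\<in>H. orbital (E g) a b) \<and>
     (\<exists>p q. a \<le> p \<and> q \<le> b \<and> (a < p \<or> q < b) \<and> nested_orbitals H n p q)"

lemma nested_orbitals_top: "nested_orbitals H n a b \<Longrightarrow> \<exists>g\<in>H. orbital (E g) a b"
  by (cases n) auto

lemma nested_orbitals_mono: "nested_orbitals K n a b \<Longrightarrow> K \<subseteq> H \<Longrightarrow> nested_orbitals H n a b"
  by (induction n arbitrary: a b) (simp; blast)+

lemma has_chain_mono: "has_chain E K \<Longrightarrow> K \<subseteq> H \<Longrightarrow> has_chain E H"
  unfolding has_chain_def by blast

lemma derived_nontrivial_imp_nested_orbitals:
  assumes "subgroup H G" "\<not> has_chain E H" "f \<in> (derived G ^^ n) H" "f \<noteq> \<one>"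
  shows "\<exists>a b. nested_orbitals H n a b"
  using assms
proof (induction n arbitrary: H)
  case 0
  then have fc: "f \<in> carrier G" by (auto intro: subgroup.mem_carrier)
  then obtain x where "E f x \<noteq> x" using E_faithful 0 by blast
  then obtain a b where "orbital (E f) a b" using ex_orbital[OF fc] by blast
  then show ?case using 0 by auto
next
  case (Suc n)
  let ?D = "derived G H"
  have D: "subgroup ?D G" "?D \<subseteq> H"
    using derived_is_subgroup[OF subgroup.subset] derived_incl Suc.prems(1) by auto
  have "\<not> has_chain E ?D" using has_chain_mono D(2) Suc.prems(2) by blast
  \<comment> \<open>One derivation is split off at the start of the series: the nest comes from
    \<open>?D\<close>, and one orbital of \<open>H\<close> is put around it.\<close>
  moreover have "f \<in> (derived G ^^ n) ?D" using Suc.prems(3) by (simp add: funpow_swap1)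
  ultimately obtain p q where pq: "nested_orbitals ?D n p q"
    using Suc.IH[OF D(1)] Suc.prems(4) by blast
  then obtain f where "f \<in> ?D" "orbital (E f) p q" using nested_orbitals_top by blast
  then obtain g a b where "g \<in> H" "orbital (E g) a b" "a < p" "q < b"
    using derived_orbital_enclosed Suc.prems(1,2) by blast
  moreover have "nested_orbitals H n p q" using nested_orbitals_mono[OF pq D(2)] .
  ultimately have "nested_orbitals H (Suc n) a b"
    unfolding nested_orbitals.simps using less_imp_le[of a p] less_imp_le[of q b] by blast
  then show ?case by blast
qed

text \<open>\<open>t\<close> is the leftmost point of largest absolute displacement. Were the map
  affine near \<open>t\<close>, the displacement at \<open>t\<close> would be the mean of its values
  at \<open>t - e\<close> and \<open>t + e\<close>, forcing an equal maximum further left.\<close>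

lemma orbital_contains_break:
  assumes f: "f \<in> carrier G" and o: "orbital (E f) a b"
  shows "\<exists>t. a < t \<and> t < b \<and> \<not> locally_affine (E f) t"
proof -
  define \<delta> where "\<delta> x = E f x - x" for x
  have ab: "a < b" and \<delta>0: "\<delta> a = 0" "\<delta> b = 0" and \<delta>n: "\<And>x. a < x \<Longrightarrow> x < b \<Longrightarrow> \<delta> x \<noteq> 0"
    using o by (auto simp: orbital_def \<delta>_def)
  have cont: "continuous_on {a..b} (\<lambda>x. \<bar>\<delta> x\<bar>)"
    unfolding \<delta>_def by (intro continuous_intros continuous_on_subset[OF E_continuous[OF f]]) auto
  obtain x1 where x1: "x1 \<in> {a..b}" "\<And>x. x \<in> {a..b} \<Longrightarrow> \<bar>\<delta> x\<bar> \<le> \<bar>\<delta> x1\<bar>"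
    using continuous_attains_sup[OF _ _ cont] ab by auto
  define K where "K = {x \<in> {a..b}. \<bar>\<delta> x\<bar> = \<bar>\<delta> x1\<bar>}"
  have "closed K"
    unfolding K_def using continuous_closed_preimage_constant[OF cont, of "\<bar>\<delta> x1\<bar>"] by simp
  moreover have "K \<noteq> {}" "bdd_below K" unfolding K_def using x1(1) by auto
  ultimately have "Inf K \<in> K" by (intro closed_contains_Inf)
  define t where "t = Inf K"
  have tK: "a \<le> t" "t \<le> b" "\<bar>\<delta> t\<bar> = \<bar>\<delta> x1\<bar>" using \<open>Inf K \<in> K\<close> by (auto simp: t_def K_def)
  have least: "t \<le> x" if "x \<in> K" for x
    unfolding t_def using that \<open>bdd_below K\<close> by (rule cInf_lower)
  obtain x2 where x2: "a < x2" "x2 < b" using dense[OF ab] by blast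
  have "0 < \<bar>\<delta> x2\<bar>" using \<delta>n x2 by simp
  also have "\<bar>\<delta> x2\<bar> \<le> \<bar>\<delta> t\<bar>" using x1(2)[of x2] x2 tK by simp
  finally have "t \<noteq> a" "t \<noteq> b" using \<delta>0 by auto
  then have t: "a < t" "t < b" using tK by auto
  have "\<not> locally_affine (E f) t"
  proof
    assume "locally_affine (E f) t"
    then obtain m c d where d: "d > 0" "\<And>x. dist x t < d \<Longrightarrow> E f x = m * x + c"
      unfolding locally_affine_def eventually_nhds_metric by blast
    define e where "e = min (d / 2) (min (t - a) (b - t))"
    have e: "0 < e" "e < d" "a \<le> t - e" "t + e \<le> b" using d(1) t by (auto simp: e_def)
    have "\<delta> (t + e) + \<delta> (t - e) = 2 * \<delta> t"
      using d e by (simp add: \<delta>_def dist_real_def algebra_simps)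
    moreover have "\<bar>\<delta> (t + e)\<bar> \<le> \<bar>\<delta> t\<bar>" "\<bar>\<delta> (t - e)\<bar> \<le> \<bar>\<delta> t\<bar>"
      using x1(2) e t tK(3) by auto
    ultimately have "\<delta> (t - e) = \<delta> t" by linarith
    then have "t - e \<in> K" using e t tK(3) by (auto simp: K_def)
    then show False using least e(1) by fastforce
  qed
  then show ?thesis using t by blast
qed

text \<open>Otherwise the map is the identity just to the left of \<open>t\<close>, and the single
  affine piece around \<open>t\<close> makes it the identity just to the right as well.\<close>

lemma locally_affine_left_orbital:
  assumes f: "f \<in> carrier G" and o: "orbital (E f) t v" and la: "locally_affine (E f) t"
  shows "\<exists>u. orbital (E f) u t"
proof (rule ccontr)
  assume no: "\<nexists>u. orbital (E f) u t"
  have tv: "t < v" "E f t = t" using o by (auto simp: orbital_def)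
  obtain m c d where d: "d > 0" "\<And>x. dist x t < d \<Longrightarrow> E f x = m * x + c"
    using la unfolding locally_affine_def eventually_nhds_metric by blast
  have "eventually (\<lambda>x. E f x = x) (at_left t)" using left_germ_cases[OF f tv(2)] no by blast
  then obtain e where e: "e < t" "\<And>x. e < x \<Longrightarrow> x < t \<Longrightarrow> E f x = x"
    by (auto simp: eventually_at_left_field)
  obtain x where x: "max e (t - d) < x" "x < t" using dense[of "max e (t - d)" t] e d by auto
  have "m * x + c = x" "m * t + c = t"
    using d(2)[of x] d(2)[of t] e(2)[of x] x tv(2) d(1) by (auto simp: dist_real_def)
  then have "(m - 1) * (t - x) = 0" by (simp add: algebra_simps)
  then have "m = 1" using x by simp
  then have "c = 0" using \<open>m * t + c = t\<close> by simp
  obtain z where z: "t < z" "z < min v (t + d)" using dense[of t "min v (t + d)"] tv d by auto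
  then have "E f z = z" using d(2)[of z] \<open>m = 1\<close> \<open>c = 0\<close> by (simp add: dist_real_def)
  then show False using o z by (auto simp: orbital_def)
qed

text \<open>Among the left ends of orbitals of \<open>y\<close> in \<open>(a, b)\<close> that lie in no translate of \<open>(p, q)\<close>, the
  least one is a break: otherwise another orbital of \<open>y\<close> would end there, starting further left.\<close>

lemma break_outside_translates:
  assumes H: "subgroup H G" and nch: "\<not> has_chain E H"
    and gy: "g \<in> H" "y \<in> H" and o: "orbital (E g) a b" "orbital (E y) p q"
    and nest: "a \<le> p" "q \<le> b" "a < p \<or> q < b"
  shows "\<exists>t. a < t \<and> t < b \<and> \<not> locally_affine (E y) t \<and> (\<forall>w\<in>H. \<not> (E w p < t \<and> t < E w q))"
proof -
  have nov: "\<not> has_left_overlap E H" "\<not> has_right_overlap E H"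
    using overlap_imp_chain[OF H] nch by blast+
  note L = inner_left[OF H nch nov(1) gy o nest]
  have yc: "y \<in> carrier G" using gy(2) H by (auto intro: subgroup.mem_carrier)
  define U where "U t \<longleftrightarrow> (\<exists>w\<in>H. E w p < t \<and> t < E w q)" for t
  define S where "S = {t. a < t \<and> t < b \<and> \<not> U t \<and> (\<exists>v. orbital (E y) t v)}"
  have "S \<subseteq> fst ` {(a, b). orbital (E y) a b}" unfolding S_def by force
  then have fin: "finite S" by (rule finite_subset) (use E_finite[OF yc] in simp)
  \<comment> \<open>This makes \<open>S\<close> nonempty: a translate with \<open>p\<close> in its
    interior would meet \<open>(p, q)\<close>, hence equal it, although \<open>p\<close> is an
    end.\<close>
  have "\<not> U p"
  proof
    assume "U p"
    then obtain w where "w \<in> H" "E w p < p" "p < E w q" unfolding U_def by blast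
    then show False using translates_disjoint(1)[OF H nch gy(2) _ o(2), of w] o(2) by (simp add: orbital_def)
  qed
  then have "p \<in> S" unfolding S_def using L(3) o(2) nest by (auto simp: orbital_def)
  then have MS: "Min S \<in> S" using fin by (intro Min_in) auto
  define t where "t = Min S"
  obtain v where t: "a < t" "t < b" "\<not> U t" "orbital (E y) t v" using MS unfolding t_def S_def by blast
  have "\<not> locally_affine (E y) t"
  proof
    assume "locally_affine (E y) t"
    then obtain u where u: "orbital (E y) u t" using locally_affine_left_orbital[OF yc t(4)] by blast
    have ut: "u < t" using u by (simp add: orbital_def)
    have au: "a < u" using right_germ_orbital[OF L(2) u] t(1) by (meson not_le)
    \<comment> \<open>A translate around \<open>u\<close> that ends before \<open>t\<close> forms a
      chain with \<open>(u, t)\<close>, one that ends at \<open>t\<close> an overlap, and a longer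
      one would contain \<open>t\<close>.\<close>
    have "\<not> U u"
    proof
      assume "U u"
      then obtain w where w: "w \<in> H" "E w p < u" "u < E w q" unfolding U_def by blast
      have wc: "w \<in> carrier G" using w(1) H by (auto intro: subgroup.mem_carrier)
      have o': "orbital (E (inv w \<otimes> y \<otimes> w)) (E w p) (E w q)" using orbital_conj[OF yc wc o(2)] .
      have y': "inv w \<otimes> y \<otimes> w \<in> H" using conj_closed[OF H gy(2) w(1)] .
      consider "E w q < t" | "E w q = t" | "t < E w q" by linarith
      then show False
      proof cases
        case 1
        then show ?thesis using nch gy(2) y' o' u w unfolding has_chain_def by blast
      next
        case 2
        then show ?thesis using nov(2) gy(2) y' o' u w unfolding has_right_overlap_def by blast
      next
        case 3
        then show ?thesis using t(3) w ut unfolding U_def by (meson less_trans)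
      qed
    qed
    then have "u \<in> S" unfolding S_def using au ut t(2) u by auto
    then show False using Min_le[OF fin] ut unfolding t_def by fastforce
  qed
  then show ?thesis using t unfolding U_def by blast
qed

lemma nested_orbitals_breaks:
  assumes H: "subgroup H G" and nch: "\<not> has_chain E H"
  shows "nested_orbitals H n a b \<Longrightarrow> \<exists>T. finite T \<and> card T = Suc n \<and> T \<subseteq> {a<..<b} \<and>
    (\<forall>t\<in>T. \<exists>y\<in>H. \<not> locally_affine (E y) t) \<and> (\<forall>s\<in>T. \<forall>t\<in>T. \<forall>w\<in>H. E w s = t \<longrightarrow> s = t)"
proof (induction n arbitrary: a b)
  case 0
  then obtain g where g: "g \<in> H" "orbital (E g) a b" by auto
  obtain t where "a < t" "t < b" "\<not> locally_affine (E g) t"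
    using orbital_contains_break[OF subgroup.mem_carrier[OF H g(1)] g(2)] by blast
  then show ?case using g(1) by (intro exI[of _ "{t}"]) auto
next
  case (Suc n)
  then obtain g p q where g: "g \<in> H" "orbital (E g) a b"
    and nest: "a \<le> p" "q \<le> b" "a < p \<or> q < b" and pq: "nested_orbitals H n p q"
    by auto
  obtain T where T: "finite T" "card T = Suc n" "T \<subseteq> {p<..<q}"
    "\<forall>t\<in>T. \<exists>y\<in>H. \<not> locally_affine (E y) t" "\<forall>s\<in>T. \<forall>t\<in>T. \<forall>w\<in>H. E w s = t \<longrightarrow> s = t"
    using Suc.IH[OF pq] by blast
  obtain y where y: "y \<in> H" "orbital (E y) p q" using nested_orbitals_top[OF pq] by blast
  obtain t where t: "a < t" "t < b" "\<not> locally_affine (E y) t"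
    "\<And>w. w \<in> H \<Longrightarrow> \<not> (E w p < t \<and> t < E w q)"
    using break_outside_translates[OF H nch g(1) y(1) g(2) y(2) nest] by blast
  \<comment> \<open>Points of \<open>T\<close> stay in translates of \<open>(p, q)\<close>, which
    avoid \<open>t\<close>; if \<open>w\<close> took \<open>t\<close> into \<open>T\<close>, then
    \<open>t\<close> would lie in the translate by \<open>inv w\<close>.\<close>
  have out: "E w s \<noteq> t" "E w t \<noteq> s" if "s \<in> T" "w \<in> H" for s w
  proof -
    have wc: "w \<in> carrier G" and iw: "inv w \<in> H"
      using that(2) H by (auto intro: subgroup.mem_carrier subgroup.m_inv_closed)
    have s: "p < s" "s < q" using that(1) T(3) by auto
    show "E w s \<noteq> t" using t(4)[OF that(2)] s wc by (auto simp del: E_less simp: E_less[OF wc])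
    show "E w t \<noteq> s" using t(4)[OF iw] s wc by (auto simp: E_inv_less_iff less_E_inv_iff)
  qed
  have "t \<notin> T" using out(1)[of t \<one>] subgroup.one_closed[OF H] by auto
  moreover have "insert t T \<subseteq> {a<..<b}" using T(3) nest t by force
  moreover have "\<forall>s\<in>insert t T. \<forall>r\<in>insert t T. \<forall>w\<in>H. E w s = r \<longrightarrow> s = r"
    using T(5) out by blast
  moreover have "\<forall>s\<in>insert t T. \<exists>y\<in>H. \<not> locally_affine (E y) s"
    using T(4) t(3) y(1) by blast
  ultimately show ?case using T(1,2) by (intro exI[of _ "insert t T"]) simp
qed

section \<open>Breaks of products and the count of their orbits\<close>

lemma E_filterlim_nhds: "f \<in> carrier G \<Longrightarrow> filterlim (E f) (nhds (E f t)) (nhds t)"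
  using E_continuous[of f]
  by (simp add: continuous_on_eq_continuous_at continuous_at tendsto_at_iff_tendsto_nhds)

lemma locally_affine_mult:
  assumes c: "f \<in> carrier G" "g \<in> carrier G"
    and la: "locally_affine (E f) t" "locally_affine (E g) (E f t)"
  shows "locally_affine (E (f \<otimes> g)) t"
proof -
  obtain m c' where f: "eventually (\<lambda>x. E f x = m * x + c') (nhds t)"
    using la(1) unfolding locally_affine_def by blast
  obtain n d where "eventually (\<lambda>x. E g x = n * x + d) (nhds (E f t))"
    using la(2) unfolding locally_affine_def by blast
  then have "eventually (\<lambda>x. E g (E f x) = n * E f x + d) (nhds t)"
    using E_filterlim_nhds[OF c(1)] by (rule eventually_compose_filterlim)
  then have "eventually (\<lambda>x. E (f \<otimes> g) x = (n * m) * x + (n * c' + d)) (nhds t)"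
    using f
  proof eventually_elim
    case (elim x)
    then show ?case using c by (simp add: E_mult algebra_simps)
  qed
  then show ?thesis unfolding locally_affine_def by blast
qed

lemma locally_affine_inv:
  assumes f: "f \<in> carrier G" and la: "locally_affine (E f) (E (inv f) t)"
  shows "locally_affine (E (inv f)) t"
proof -
  obtain m c where "eventually (\<lambda>x. E f x = m * x + c) (nhds (E (inv f) t))"
    using la unfolding locally_affine_def by blast
  then have "eventually (\<lambda>x. E f (E (inv f) x) = m * E (inv f) x + c) (nhds t)"
    using E_filterlim_nhds[OF inv_closed[OF f]] by (rule eventually_compose_filterlim)
  then have ev: "eventually (\<lambda>x. x = m * E (inv f) x + c) (nhds t)" using f by simp
  have "m \<noteq> 0"
  proof
    assume "m = 0"
    then obtain d where d: "d > 0" "\<And>x. dist x t < d \<Longrightarrow> x = c"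
      using ev unfolding eventually_nhds_metric by auto
    have "t = c" by (rule d(2)) (simp add: d(1))
    moreover have "t + d / 2 = c" by (rule d(2)) (use d(1) in \<open>simp add: dist_real_def\<close>)
    ultimately show False using d(1) by simp
  qed
  have "eventually (\<lambda>x. E (inv f) x = (1 / m) * x + (- c / m)) (nhds t)"
    using ev
  proof eventually_elim
    case (elim x)
    then have "m * E (inv f) x = x - c" by linarith
    then have "E (inv f) x = (x - c) / m" using \<open>m \<noteq> 0\<close> by (simp add: eq_divide_eq mult.commute)
    then show ?case by (simp add: diff_divide_distrib)
  qed
  then show ?thesis unfolding locally_affine_def by blast
qed

text \<open>By the chain rule a word breaks at \<open>t\<close> only if one of its letters breaks at
  the image of \<open>t\<close> under the letters before it.\<close>

lemma generate_break:
  assumes X: "X \<subseteq> carrier G" and y: "y \<in> generate G X" and br: "\<not> locally_affine (E y) t"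
  shows "\<exists>w\<in>generate G X. \<exists>x\<in>X. \<not> locally_affine (E x) (E w t)"
  using y br
proof (induction arbitrary: t rule: generate.induct)
  case one
  have "eventually (\<lambda>x. E \<one> x = 1 * x + 0) (nhds t)" by simp
  then show ?case using one unfolding locally_affine_def by blast
next
  case (incl h)
  then show ?case using generate.one[of G X] by (metis E_one)
next
  case (inv h)
  \<comment> \<open>Here \<open>w\<close> is \<open>inv h\<close> itself: the inverse breaks at
    \<open>t\<close> only if \<open>h\<close> breaks at the preimage of \<open>t\<close>.\<close>
  then show ?case using generate.inv[of h X G] locally_affine_inv[of h t] X by blast
next
  case (eng h1 h2)
  have c: "h1 \<in> carrier G" "h2 \<in> carrier G" using eng(1,2) generate_in_carrier[OF X] by auto
  show ?case
  proof (cases "locally_affine (E h1) t")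
    case True
    then have "\<not> locally_affine (E h2) (E h1 t)" using locally_affine_mult[OF c] eng.prems by blast
    then obtain w x where w: "w \<in> generate G X" "x \<in> X" "\<not> locally_affine (E x) (E w (E h1 t))"
      using eng.IH(2) by blast
    then have "w \<in> carrier G" using generate_in_carrier[OF X] by auto
    then have "E (h1 \<otimes> w) t = E w (E h1 t)" using c by (simp add: E_mult)
    then show ?thesis using w generate.eng[OF eng(1) w(1)] by metis
  next
    case False
    then show ?thesis using eng.IH(1) by blast
  qed
qed

text \<open>Only breaks that the group moves have to lie in \<open>B\<close>. This leaves room for
  the artificial breaks that extension by the identity can create at 0 and 1.\<close>

lemma derived_trivial_if_no_chain:
  assumes X: "X \<subseteq> carrier G" and nch: "\<not> has_chain E (generate G X)"
    and B: "finite B" "\<And>x t y. x \<in> X \<Longrightarrow> \<not> locally_affine (E x) t \<Longrightarrow> y \<in> generate G X \<Longrightarrow> E y t \<noteq> t \<Longrightarrow> t \<in> B"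
  shows "(derived G ^^ card B) (generate G X) = {\<one>}"
proof (rule ccontr)
  let ?H = "generate G X"
  assume ne: "(derived G ^^ card B) ?H \<noteq> {\<one>}"
  have H: "subgroup ?H G" using generate_is_subgroup[OF X] .
  have "\<one> \<in> (derived G ^^ card B) ?H"
    using subgroup.one_closed[OF exp_of_derived_is_subgroup[OF H]] .
  then obtain f where f: "f \<in> (derived G ^^ card B) ?H" "f \<noteq> \<one>" using ne by blast
  obtain a b where ab: "nested_orbitals ?H (card B) a b"
    using derived_nontrivial_imp_nested_orbitals[OF H nch f] by blast
  then obtain g where g: "g \<in> ?H" "orbital (E g) a b" using nested_orbitals_top by blast
  obtain T where T: "finite T" "card T = Suc (card B)" "T \<subseteq> {a<..<b}"
    "\<forall>t\<in>T. \<exists>y\<in>?H. \<not> locally_affine (E y) t" "\<forall>s\<in>T. \<forall>t\<in>T. \<forall>w\<in>?H. E w s = t \<longrightarrow> s = t"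
    using nested_orbitals_breaks[OF H nch ab] by meson
  have "\<exists>w\<in>?H. E w t \<in> B" if t: "t \<in> T" for t
  proof -
    obtain y where "y \<in> ?H" "\<not> locally_affine (E y) t" using T(4) t by blast
    then obtain w x where w: "w \<in> ?H" "x \<in> X" "\<not> locally_affine (E x) (E w t)"
      using generate_break[OF X] by blast
    have c: "w \<in> carrier G" "g \<in> carrier G" using w(1) g(1) H by (auto intro: subgroup.mem_carrier)
    \<comment> \<open>All of \<open>T\<close> lies in an orbital of \<open>g\<close>, so a conjugate
      of \<open>g\<close> moves the image of \<open>t\<close>, as membership in \<open>B\<close>
      demands.\<close>
    have "E g t \<noteq> t" using T(3) t g(2) by (auto simp: orbital_def)
    then have "E (inv w \<otimes> g \<otimes> w) (E w t) \<noteq> E w t" using c by (simp add: E_conj)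
    then show ?thesis using B(2)[OF w(2,3) conj_closed[OF H g(1) w(1)]] w(1) by blast
  qed
  then obtain W where W: "\<And>t. t \<in> T \<Longrightarrow> W t \<in> ?H" "\<And>t. t \<in> T \<Longrightarrow> E (W t) t \<in> B" by metis
  have "inj_on (\<lambda>t. E (W t) t) T"
  proof (rule inj_onI)
    fix s t assume st: "s \<in> T" "t \<in> T" "E (W s) s = E (W t) t"
    have c: "W s \<in> carrier G" "W t \<in> carrier G" using W(1) st H by (auto intro: subgroup.mem_carrier)
    have "W s \<otimes> inv (W t) \<in> ?H" using W(1) st H by (simp add: subgroup.m_closed subgroup.m_inv_closed)
    moreover have "E (W s \<otimes> inv (W t)) s = t" using c st(3) by (simp add: E_mult)
    ultimately show "s = t" using T(5) st by blast
  qed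
  then have "card T \<le> card B" using W(2) B(1) by (intro card_inj_on_le) auto
  then show False using T(2) by simp
qed

end

section \<open>The action of \<open>PL_I\<close>\<close>

definition extend :: "(real \<Rightarrow> real) \<Rightarrow> real \<Rightarrow> real" where
  "extend f x = (if x \<in> {0..1} then f x else x)"

lemma carrier_PL_I [simp]: "carrier PL_I = PL_homeos"
  by (simp add: PL_I_def)

lemma PL_homeos_range: "f \<in> PL_homeos \<Longrightarrow> f ` {0..1} = {0..1}"
  using PL_homeosD(2) by (simp add: bij_betw_def)

lemma PL_homeos_le_iff:
  "f \<in> PL_homeos \<Longrightarrow> x \<in> {0..1} \<Longrightarrow> y \<in> {0..1} \<Longrightarrow> f x \<le> f y \<longleftrightarrow> x \<le> y"
  using strict_mono_on_less_eq[OF PL_homeosD(4)] by blast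

lemma PL_homeos_ends:
  assumes f: "f \<in> PL_homeos"
  shows "f 0 = 0" "f 1 = 1"
proof -
  have "0 \<in> f ` {0..1}" "1 \<in> f ` {0..1}" using PL_homeos_range[OF f] by auto
  then obtain x y where xy: "x \<in> {0..1}" "f x = 0" "y \<in> {0..1}" "f y = 1" by force
  have "f 0 \<in> {0..1}" "f 1 \<in> {0..1}" using PL_homeos_range[OF f] by auto
  moreover have "f 0 \<le> f x" "f y \<le> f 1" using PL_homeos_le_iff[OF f, of 0 x] PL_homeos_le_iff[OF f, of y 1] xy(1,3) by auto
  ultimately show "f 0 = 0" "f 1 = 1" using xy by auto
qed

lemma orbital_extend_bounds:
  assumes "orbital (extend f) a b"
  shows "0 \<le> a" "b \<le> 1"
proof -
  have ab: "a < b" and mv: "\<And>x. a < x \<Longrightarrow> x < b \<Longrightarrow> x \<in> {0..1}"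
    using assms unfolding orbital_def extend_def by (auto split: if_splits)
  show "0 \<le> a"
  proof (rule ccontr)
    assume "\<not> 0 \<le> a"
    then obtain x where "a < x" "x < min 0 b" using dense[of a "min 0 b"] ab by auto
    then show False using mv[of x] by auto
  qed
  show "b \<le> 1"
  proof (rule ccontr)
    assume "\<not> b \<le> 1"
    then obtain x where "max 1 a < x" "x < b" using dense[of "max 1 a" b] ab by auto
    then show False using mv[of x] by auto
  qed
qed

lemma extend_germ_right:
  assumes f: "f \<in> PL_homeos"
  shows "\<exists>m c. eventually (\<lambda>x. extend f x = m * x + c) (at_right z)"
proof (cases "0 \<le> z \<and> z < 1")
  case True
  obtain S where S: "finite S" "\<And>a b. 0 \<le> a \<Longrightarrow> a \<le> b \<Longrightarrow> b \<le> 1 \<Longrightarrow> S \<inter> {a<..<b} = {} \<Longrightarrow>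
    \<exists>m c. \<forall>x\<in>{a..b}. f x = m * x + c"
    using PL_homeosD(5)[OF f] unfolding piecewise_linear_on_I_def by metis
  \<comment> \<open>The next point of \<open>S\<close> after \<open>z\<close>, or 1 if there is none
    before it.\<close>
  define b where "b = Min (insert 1 (S \<inter> {z<..}))"
  have "b \<in> insert 1 (S \<inter> {z<..})" unfolding b_def using S(1) by (intro Min_in) auto
  then have zb: "z < b" using True by auto
  have le: "b \<le> s" if "s \<in> insert 1 (S \<inter> {z<..})" for s
    unfolding b_def using S(1) that by (intro Min_le) auto
  have "S \<inter> {z<..<b} = {}" using le by force
  then obtain m c where mc: "\<forall>x\<in>{z..b}. f x = m * x + c" using S(2)[of z b] True zb le[of 1] by auto
  have "eventually (\<lambda>x. extend f x = m * x + c) (at_right z)"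
    unfolding eventually_at_right_field
    using zb mc True le[of 1] by (intro exI[of _ b]) (auto simp: extend_def)
  then show ?thesis by blast
next
  case False
  have "eventually (\<lambda>x. extend f x = 1 * x + 0) (at_right z)"
  proof (cases "z < 0")
    case True
    then show ?thesis unfolding eventually_at_right_field by (intro exI[of _ 0]) (auto simp: extend_def)
  next
    case z: False
    then show ?thesis using False unfolding eventually_at_right_field
      by (intro exI[of _ "z + 1"]) (auto simp: extend_def)
  qed
  then show ?thesis by blast
qed

lemma extend_germ_left:
  assumes f: "f \<in> PL_homeos"
  shows "\<exists>m c. eventually (\<lambda>x. extend f x = m * x + c) (at_left z)"
proof (cases "0 < z \<and> z \<le> 1")
  case True
  obtain S where S: "finite S" "\<And>a b. 0 \<le> a \<Longrightarrow> a \<le> b \<Longrightarrow> b \<le> 1 \<Longrightarrow> S \<inter> {a<..<b} = {} \<Longrightarrow>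
    \<exists>m c. \<forall>x\<in>{a..b}. f x = m * x + c"
    using PL_homeosD(5)[OF f] unfolding piecewise_linear_on_I_def by metis
  define a where "a = Max (insert 0 (S \<inter> {..<z}))"
  have "a \<in> insert 0 (S \<inter> {..<z})" unfolding a_def using S(1) by (intro Max_in) auto
  then have az: "a < z" using True by auto
  have ge: "s \<le> a" if "s \<in> insert 0 (S \<inter> {..<z})" for s
    unfolding a_def using S(1) that by (intro Max_ge) auto
  have "S \<inter> {a<..<z} = {}" using ge by force
  then obtain m c where mc: "\<forall>x\<in>{a..z}. f x = m * x + c" using S(2)[of a z] True az ge[of 0] by auto
  have "eventually (\<lambda>x. extend f x = m * x + c) (at_left z)"
    unfolding eventually_at_left_field
    using az mc True ge[of 0] by (intro exI[of _ a]) (auto simp: extend_def)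
  then show ?thesis by blast
next
  case False
  have "eventually (\<lambda>x. extend f x = 1 * x + 0) (at_left z)"
  proof (cases "1 < z")
    case True
    then show ?thesis unfolding eventually_at_left_field by (intro exI[of _ 1]) (auto simp: extend_def)
  next
    case z: False
    then show ?thesis using False unfolding eventually_at_left_field
      by (intro exI[of _ "z - 1"]) (auto simp: extend_def)
  qed
  then show ?thesis by blast
qed

text \<open>An affine map fixing both ends of an interval is the identity there, so every orbital
  contains a point of \<open>S\<close>; and no point lies in two orbitals.\<close>

lemma finite_orbitals_extend:
  assumes f: "f \<in> PL_homeos"
  shows "finite {(a, b). orbital (extend f) a b}"
proof -
  obtain S where S: "finite S" "\<And>a b. 0 \<le> a \<Longrightarrow> a \<le> b \<Longrightarrow> b \<le> 1 \<Longrightarrow> S \<inter> {a<..<b} = {} \<Longrightarrow>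
    \<exists>m c. \<forall>x\<in>{a..b}. f x = m * x + c"
    using PL_homeosD(5)[OF f] unfolding piecewise_linear_on_I_def by metis
  have meets: "S \<inter> {a<..<b} \<noteq> {}" if o: "orbital (extend f) a b" for a b
  proof
    assume "S \<inter> {a<..<b} = {}"
    then obtain m c where mc: "\<And>x. x \<in> {a..b} \<Longrightarrow> extend f x = m * x + c"
      using S(2)[of a b] orbital_extend_bounds[OF o] o unfolding orbital_def extend_def by auto
    have "m * a + c = a" "m * b + c = b" "a < b"
      using mc[of a] mc[of b] o by (auto simp: orbital_def)
    then have "(m - 1) * (b - a) = 0" "a < b" by (simp_all add: algebra_simps)
    then have "m = 1" "c = 0" using \<open>m * a + c = a\<close> by auto
    moreover obtain x where "a < x" "x < b" using dense[OF \<open>a < b\<close>] by blast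
    ultimately show False using mc[of x] o by (simp add: orbital_def)
  qed
  have "finite {(a, b). orbital (extend f) a b \<and> a < s \<and> s < b}" for s
  proof (cases "\<exists>a b. orbital (extend f) a b \<and> a < s \<and> s < b")
    case True
    then obtain a b where ab: "orbital (extend f) a b" "a < s" "s < b" by blast
    have "{(a, b). orbital (extend f) a b \<and> a < s \<and> s < b} \<subseteq> {(a, b)}"
    proof clarify
      fix c d assume cd: "orbital (extend f) c d" "c < s" "s < d"
      then show "c = a \<and> d = b"
        using orbitals_meet_eq[OF cd(1) ab(1)] ab by linarith
    qed
    then show ?thesis by (rule finite_subset) simp
  next
    case False
    then have "{(a, b). orbital (extend f) a b \<and> a < s \<and> s < b} = {}" by blast
    then show ?thesis by (metis finite.emptyI)
  qed
  then have "finite (\<Union>s\<in>S. {(a, b). orbital (extend f) a b \<and> a < s \<and> s < b})" using S(1) by blast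
  moreover have "{(a, b). orbital (extend f) a b} \<subseteq>
      (\<Union>s\<in>S. {(a, b). orbital (extend f) a b \<and> a < s \<and> s < b})"
    using meets by fastforce
  ultimately show ?thesis by (rule rev_finite_subset)
qed

text \<open>Elements of \<open>PL_I\<close> are \<open>undefined\<close> outside the unit interval; extended by the identity they form
  an action on the whole line.\<close>

lemma pl_action_extend: "pl_action PL_I extend"
proof (intro pl_action.intro pl_action_axioms.intro)
  show "group PL_I" by (rule group_PL_I)
  fix f assume "f \<in> carrier PL_I"
  then have f: "f \<in> PL_homeos" by simp
  note range = PL_homeos_range[OF f] and ends = PL_homeos_ends[OF f]
  have fI: "f x \<in> {0..1}" if "x \<in> {0..1}" for x using range that by blast
  show "extend (f \<otimes>\<^bsub>PL_I\<^esub> g) x = extend g (extend f x)" for g x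
    using fI[of x] by (auto simp: PL_I_def extend_def compose_def)
  show "strict_mono (extend f)"
  proof (rule strict_monoI)
    fix x y :: real assume xy: "x < y"
    consider "x \<in> {0..1}" "y \<in> {0..1}" | "x < 0 \<or> 1 < y" | "1 < x \<or> y < 0" using xy by force
    then show "extend f x < extend f y"
    proof cases
      case 1
      then show ?thesis using strict_mono_onD[OF PL_homeosD(4)[OF f]] xy by (simp add: extend_def)
    qed (use xy fI[of x] fI[of y] in \<open>auto simp: extend_def\<close>)
  qed
  have "continuous_on {0..1} (extend f)"
    using PL_homeosD(3)[OF f] by (rule continuous_on_eq) (simp add: extend_def)
  moreover have "continuous_on {..0} (extend f)" "continuous_on {1..} (extend f)"
    by (rule continuous_on_eq[OF continuous_on_id]; use ends in \<open>auto simp: extend_def\<close>)+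
  ultimately have "continuous_on ({..0} \<union> {0..1} \<union> {1..}) (extend f)"
    by (intro continuous_on_closed_Un) auto
  moreover have "{..0} \<union> {0..1} \<union> {1..} = (UNIV :: real set)" by auto
  ultimately show "continuous_on UNIV (extend f)" by metis
  show "f = \<one>\<^bsub>PL_I\<^esub>" if id: "\<And>x. extend f x = x"
  proof
    fix x show "f x = \<one>\<^bsub>PL_I\<^esub> x"
      using id[of x] PL_homeosD(1)[OF f] by (cases "x \<in> {0..1}") (auto simp: PL_I_def extend_def extensional_def)
  qed
  show "\<exists>M. \<forall>x. M \<le> \<bar>x\<bar> \<longrightarrow> extend f x = x" by (intro exI[of _ 2]) (auto simp: extend_def)
  show "\<exists>m c. \<forall>\<^sub>F x in at_right z. extend f x = m * x + c" for z by (rule extend_germ_right[OF f])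
  show "\<exists>m c. \<forall>\<^sub>F x in at_left z. extend f x = m * x + c" for z by (rule extend_germ_left[OF f])
  show "finite {(a, b). orbital (extend f) a b}" by (rule finite_orbitals_extend[OF f])
qed

section \<open>Components of support as orbitals\<close>

lemma support_eq_extend: "support f = {x. extend f x \<noteq> x}"
  by (auto simp: support_def extend_def)

lemma orbital_imp_component:
  assumes "orbital \<phi> a b"
  shows "{a<..<b} \<in> components {x. \<phi> x \<noteq> x}"
  unfolding in_components_maximal
proof (intro conjI allI impI)
  show "{a<..<b} \<noteq> {}" "{a<..<b} \<subseteq> {x. \<phi> x \<noteq> x}" "connected {a<..<b}"
    using assms by (auto simp: orbital_def)
  fix D assume "D \<noteq> {} \<and> {a<..<b} \<subseteq> D \<and> D \<subseteq> {x. \<phi> x \<noteq> x} \<and> connected D"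
  then have D: "{a<..<b} \<subseteq> D" "D \<subseteq> {x. \<phi> x \<noteq> x}" "connected D" by auto
  have "a < b" "a \<notin> D" "b \<notin> D" using assms D(2) by (auto simp: orbital_def)
  obtain x where x: "a < x" "x < b" "x \<in> D" using dense[OF \<open>a < b\<close>] D(1) by auto
  have "D \<subseteq> {a<..<b}"
  proof
    fix y assume "y \<in> D"
    then have "\<not> y \<le> a" "\<not> b \<le> y"
      using connectedD_interval[OF D(3) \<open>y \<in> D\<close> x(3), of a] connectedD_interval[OF D(3) x(3) \<open>y \<in> D\<close>, of b]
        x \<open>a \<notin> D\<close> \<open>b \<notin> D\<close> by auto
    then show "y \<in> {a<..<b}" by simp
  qed
  then show "D = {a<..<b}" using D(1) by blast
qed

lemma component_support_iff:
  assumes f: "f \<in> PL_homeos"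
  shows "A \<in> components (support f) \<longleftrightarrow> (\<exists>a b. A = {a<..<b} \<and> orbital (extend f) a b)"
proof
  interpret pl_action PL_I extend by (rule pl_action_extend)
  assume A: "A \<in> components (support f)"
  then obtain x where x: "x \<in> A" "extend f x \<noteq> x"
    using in_components_nonempty in_components_subset support_eq_extend by blast
  then obtain a b where ab: "a < x" "x < b" "orbital (extend f) a b" using ex_orbital[of f x] f by auto
  then have "{a<..<b} \<in> components (support f)"
    using orbital_imp_component by (simp add: support_eq_extend)
  then have "A = {a<..<b}" using components_nonoverlap[OF A] x ab by fastforce
  then show "\<exists>a b. A = {a<..<b} \<and> orbital (extend f) a b" using ab by blast
next
  assume "\<exists>a b. A = {a<..<b} \<and> orbital (extend f) a b"
  then show "A \<in> components (support f)"
    using orbital_imp_component by (auto simp: support_eq_extend)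
qed

lemma interval_component_support_iff:
  assumes f: "f \<in> PL_homeos"
  shows "{a<..<b} \<in> components (support f) \<longleftrightarrow> orbital (extend f) a b"
proof
  assume *: "{a<..<b} \<in> components (support f)"
  then have "{a<..<b} \<noteq> {}" using in_components_nonempty by blast
  moreover obtain c d where cd: "{a<..<b} = {c<..<d}" "orbital (extend f) c d"
    using component_support_iff[OF f, THEN iffD1, OF *] by blast
  moreover have "c < d" using cd(2) by (simp add: orbital_def)
  ultimately have "a = c \<and> b = d"
    using greaterThanLessThan_subseteq_greaterThanLessThan[of a b c d]
      greaterThanLessThan_subseteq_greaterThanLessThan[of c d a b] by auto
  then show "orbital (extend f) a b" using cd(2) by simp
next
  assume "orbital (extend f) a b"
  then show "{a<..<b} \<in> components (support f)"
    using orbital_imp_component[of "extend f" a b] by (simp add: support_eq_extend)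
qed

lemma transition_chain_iff:
  assumes "G \<subseteq> PL_homeos"
  shows "transition_chain G \<longleftrightarrow> has_chain extend G"
  unfolding transition_chain_def has_chain_def
  by (simp add: interval_component_support_iff[OF subsetD[OF assms]] cong: bex_cong)

lemma one_sided_overlap_iff:
  assumes "G \<subseteq> PL_homeos"
  shows "one_sided_overlap G \<longleftrightarrow> has_left_overlap extend G \<or> has_right_overlap extend G"
proof -
  have "one_sided_overlap G \<longleftrightarrow> (\<exists>g\<in>G. \<exists>h\<in>G. \<exists>a b c. a < c \<and> c < b \<and> orbital (extend g) a b \<and>
      (orbital (extend h) a c \<or> orbital (extend h) c b))"
    unfolding one_sided_overlap_def
    by (simp add: interval_component_support_iff[OF subsetD[OF assms]] cong: bex_cong)
  also have "\<dots> \<longleftrightarrow> has_left_overlap extend G \<or> has_right_overlap extend G"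
    unfolding has_left_overlap_def has_right_overlap_def orbital_def by blast
  finally show ?thesis .
qed

lemma infinite_tower_iff:
  assumes G: "G \<subseteq> PL_homeos"
  shows "infinite_tower G \<longleftrightarrow> has_tower extend G"
proof -
  have psub: "{c<..<d} \<subset> {a<..<b} \<longleftrightarrow> a \<le> c \<and> d \<le> b \<and> (a < c \<or> d < b)"
    if "orbital \<phi> a b" "orbital \<psi> c d" for \<phi> \<psi> a b c d
    using that unfolding less_le_not_le[of "{c<..<d}"] orbital_def
    by (auto simp: greaterThanLessThan_subseteq_greaterThanLessThan)
  show ?thesis
  proof
    assume "infinite_tower G"
    then obtain g A where "\<forall>i::nat. g i \<in> G \<and> A i \<in> components (support (g i)) \<and> A (Suc i) \<subset> A i"
      unfolding infinite_tower_def by (elim exE) (rule that)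
    then have gA: "g i \<in> G" "A i \<in> components (support (g i))" "A (Suc i) \<subset> A i" for i by simp_all
    have "\<exists>a b. A i = {a<..<b} \<and> orbital (extend (g i)) a b" for i
      using component_support_iff[THEN iffD1, OF subsetD[OF G gA(1)] gA(2)] .
    then obtain a b where ab: "\<And>i. A i = {a i<..<b i}" "\<And>i. orbital (extend (g i)) (a i) (b i)" by metis
    have "a i \<le> a (Suc i) \<and> b (Suc i) \<le> b i \<and> (a i < a (Suc i) \<or> b (Suc i) < b i)" for i
      using psub[OF ab(2) ab(2), of "Suc i" i] gA(3)[of i] ab(1) by simp
    then show "has_tower extend G" unfolding has_tower_def using gA(1) ab(2) by blast
  next
    assume "has_tower extend G"
    then obtain g a b where "\<forall>i::nat. g i \<in> G \<and> orbital (extend (g i)) (a i) (b i) \<and>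
        a i \<le> a (Suc i) \<and> b (Suc i) \<le> b i \<and> (a i < a (Suc i) \<or> b (Suc i) < b i)"
      unfolding has_tower_def by (elim exE) (rule that)
    then have T: "g i \<in> G" "orbital (extend (g i)) (a i) (b i)"
      "a i \<le> a (Suc i) \<and> b (Suc i) \<le> b i \<and> (a i < a (Suc i) \<or> b (Suc i) < b i)" for i
      by simp_all
    show "infinite_tower G"
      unfolding infinite_tower_def
    proof (intro exI[of _ g] exI[of _ "\<lambda>i. {a i<..<b i}"] allI conjI)
      fix i
      show "g i \<in> G" by (rule T(1))
      show "{a i<..<b i} \<in> components (support (g i))"
        using interval_component_support_iff[OF subsetD[OF G T(1)]] T(2) by simp
      show "{a (Suc i)<..<b (Suc i)} \<subset> {a i<..<b i}"
        using psub[OF T(2) T(2), of "Suc i" i] T(3) by simp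
    qed
  qed
qed

section \<open>Breaks and differentiability\<close>

lemma extend_eventually_eq: "0 < t \<Longrightarrow> t < 1 \<Longrightarrow> eventually (\<lambda>x. extend f x = f x) (nhds t)"
  by (rule eventually_mono[OF eventually_nhds_in_open[of "{0<..<1}"]]) (auto simp: extend_def)

text \<open>Both one-sided germs are affine; continuity fixes their common value at \<open>t\<close>
  and the derivative their common slope, so they join to one affine map.\<close>

lemma differentiable_imp_locally_affine:
  assumes f: "f \<in> PL_homeos" and t: "0 < t" "t < 1" and d: "f differentiable (at t)"
  shows "locally_affine (extend f) t"
proof -
  interpret pl_action PL_I extend by (rule pl_action_extend)
  have fc: "f \<in> carrier PL_I" using f by simp
  let ?F = "extend f"
  obtain D where "(f has_field_derivative D) (at t)"
    using d real_differentiable_def by blast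
  then have "(?F has_field_derivative D) (at t)"
    using DERIV_cong_ev[OF refl extend_eventually_eq[OF t] refl] by blast
  then have lim: "((\<lambda>x. (?F x - ?F t) / (x - t)) \<longlongrightarrow> D) (at t)"
    by (simp add: has_field_derivative_iff)
  have cont: "(?F \<longlongrightarrow> ?F t) (at t)"
    using E_continuous[OF fc] by (simp add: continuous_on_eq_continuous_at continuous_at)
  have germ: "eventually (\<lambda>x. ?F x = D * x + (?F t - D * t)) F"
    if ev: "eventually (\<lambda>x. ?F x = m * x + c) F" and F: "F \<le> at t" "F \<noteq> bot" for F m c
  proof -
    have neq: "eventually (\<lambda>x. x \<noteq> t) F"
      using F(1) by (rule filter_leD) (simp add: eventually_at_filter)
    have id: "((\<lambda>x. x) \<longlongrightarrow> t) F" using F(1) tendsto_ident_at by (rule tendsto_mono)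
    have "((\<lambda>x. m * x + c) \<longlongrightarrow> m * t + c) F" by (intro tendsto_intros id)
    moreover have "((\<lambda>x. m * x + c) \<longlongrightarrow> ?F t) F"
      using tendsto_mono[OF F(1) cont] tendsto_cong[OF ev] by simp
    ultimately have Ft: "?F t = m * t + c" using F(2) tendsto_unique by blast
    have "eventually (\<lambda>x. (?F x - ?F t) / (x - t) = m) F"
      using ev neq by eventually_elim (simp add: Ft field_simps)
    then have "((\<lambda>x. (?F x - ?F t) / (x - t)) \<longlongrightarrow> m) F" by (rule tendsto_eventually)
    then have "m = D" using tendsto_mono[OF F(1) lim] F(2) tendsto_unique by blast
    then show ?thesis using ev Ft by simp
  qed
  have "eventually (\<lambda>x. ?F x = D * x + (?F t - D * t)) (at_right t)"
    using E_right[OF fc, of t] germ[of _ _ "at_right t"] by (auto simp: at_le)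
  moreover have "eventually (\<lambda>x. ?F x = D * x + (?F t - D * t)) (at_left t)"
    using E_left[OF fc, of t] germ[of _ _ "at_left t"] by (auto simp: at_le)
  ultimately have "eventually (\<lambda>x. ?F x = D * x + (?F t - D * t)) (at t)"
    by (simp add: eventually_at_split)
  then have "eventually (\<lambda>x. ?F x = D * x + (?F t - D * t)) (nhds t)"
    by (simp add: eventually_at_filter) (auto elim!: eventually_mono)
  then show ?thesis unfolding locally_affine_def by blast
qed

lemma finite_breakpoints:
  assumes "finite X" "X \<subseteq> PL_homeos"
  shows "finite (breakpoints X)"
proof -
  have "finite {t \<in> {0<..<1}. \<not> f differentiable (at t)}" if "f \<in> X" for f
  proof -
    have f: "f \<in> PL_homeos" using that assms by blast
    obtain S where S: "finite S" "\<And>a b. 0 \<le> a \<Longrightarrow> a \<le> b \<Longrightarrow> b \<le> 1 \<Longrightarrow> S \<inter> {a<..<b} = {} \<Longrightarrow>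
      \<exists>m c. \<forall>x\<in>{a..b}. f x = m * x + c"
    using PL_homeosD(5)[OF f] unfolding piecewise_linear_on_I_def by metis
    have "t \<in> S" if t: "0 < t" "t < 1" "\<not> f differentiable (at t)" for t
    proof (rule ccontr)
      assume "t \<notin> S"
      have "open ({0<..<1} - S)" using S(1) by (intro open_Diff finite_imp_closed) auto
      then obtain e where e: "e > 0" "cball t e \<subseteq> {0<..<1} - S"
        using t \<open>t \<notin> S\<close> by (metis Diff_iff greaterThanLessThan_iff open_contains_cball)
      have sub: "{t - e..t + e} \<subseteq> {0<..<1} - S" using e(2) by (simp add: cball_eq_atLeastAtMost)
      then have "0 \<le> t - e" "t + e \<le> 1"
        using e(1) subsetD[OF sub, of "t - e"] subsetD[OF sub, of "t + e"] by auto
      moreover have "S \<inter> {t - e<..<t + e} = {}"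
        using sub greaterThanLessThan_subseteq_atLeastAtMost_iff[of "t - e" "t + e" "t - e" "t + e"] by blast
      ultimately obtain m c where mc: "\<forall>x\<in>{t - e..t + e}. f x = m * x + c"
        using S(2)[of "t - e" "t + e"] e(1) by auto
      have "eventually (\<lambda>x. x \<in> {t - e<..<t + e}) (nhds t)"
        using e(1) by (intro eventually_nhds_in_open) auto
      then have "eventually (\<lambda>x. f x = m * x + c) (nhds t)"
        by eventually_elim (use mc in auto)
      moreover have "((\<lambda>x. m * x + c) has_field_derivative m) (at t)"
        by (auto intro!: derivative_eq_intros)
      ultimately have "(f has_field_derivative m) (at t)"
        using DERIV_cong_ev[of t t f "\<lambda>x. m * x + c" m m] by simp
      then show False using t(3) real_differentiable_def by blast
    qed
    then have "{t \<in> {0<..<1}. \<not> f differentiable (at t)} \<subseteq> S" by auto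
    then show ?thesis using S(1) finite_subset by blast
  qed
  then have "finite (\<Union>f\<in>X. {t \<in> {0<..<1}. \<not> f differentiable (at t)})" using assms(1) by blast
  moreover have "breakpoints X = (\<Union>f\<in>X. {t \<in> {0<..<1}. \<not> f differentiable (at t)})"
    unfolding breakpoints_def by blast
  ultimately show ?thesis by simp
qed

text \<open>Solubility is stated for the subgroup as a group of its own, whereas orbital arguments
  form derived subgroups inside the ambient group.\<close>

lemma (in group) exp_of_derived_consistent:
  assumes H: "subgroup H G"
  shows "(derived (G\<lparr>carrier := H\<rparr>) ^^ n) H = (derived G ^^ n) H \<and> (derived G ^^ n) H \<subseteq> H"
proof (induction n)
  case (Suc n)
  then show ?case using derived_consistent[OF _ H] derived_incl[OF _ H] by simp
qed simp

theorem theorem3p2: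
  fixes X G :: "(real \<Rightarrow> real) set"
  assumes "finite X" and "X \<subseteq> carrier PL_I"
    and "subgroup G PL_I" and "G = generate PL_I X"
  shows "(\<not> solvable (PL_I\<lparr>carrier := G\<rparr>) \<longleftrightarrow> transition_chain G)
    \<and> (transition_chain G \<longleftrightarrow> one_sided_overlap G)
    \<and> (one_sided_overlap G \<longleftrightarrow> infinite_tower G)
    \<and> (solvable (PL_I\<lparr>carrier := G\<rparr>) \<longrightarrow>
         derived_length (PL_I\<lparr>carrier := G\<rparr>) \<le> card (breakpoints X))"
proof -
  interpret pl_action PL_I extend by (rule pl_action_extend)
  have GPL: "G \<subseteq> PL_homeos" using subgroup.subset[OF assms(3)] by simp
  have XPL: "X \<subseteq> PL_homeos" using assms(2) by simp
  let ?G = "PL_I\<lparr>carrier := G\<rparr>"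
  have grp: "group ?G" using subgroup_imp_group[OF assms(3)] .
  have der: "(derived ?G ^^ n) G = (derived PL_I ^^ n) G" for n
    using exp_of_derived_consistent[OF assms(3)] by blast
  have solv: "solvable ?G \<longleftrightarrow> (\<exists>n. (derived PL_I ^^ n) G = {\<one>\<^bsub>PL_I\<^esub>})"
    using group.solvable_iff_trivial_derived_seq[OF grp] der by simp
  have bound: "(derived PL_I ^^ card (breakpoints X)) G = {\<one>\<^bsub>PL_I\<^esub>}" if "\<not> has_chain extend G"
    unfolding assms(4)
  proof (rule derived_trivial_if_no_chain[OF assms(2)])
    show "\<not> has_chain extend (generate PL_I X)" using that assms(4) by simp
    show "finite (breakpoints X)" using finite_breakpoints assms(1) XPL by blast
    fix x t y assume xty: "x \<in> X" "\<not> locally_affine (extend x) t" "y \<in> generate PL_I X" "extend y t \<noteq> t"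
    then have y: "y \<in> PL_homeos" using GPL assms(4) by blast
    \<comment> \<open>Every extended element fixes 0, 1 and all points outside the interval, so a
      moved break is interior.\<close>
    have "0 < t \<and> t < 1"
      using xty(4) PL_homeos_ends[OF y] by (auto simp: extend_def less_le split: if_splits)
    then show "t \<in> breakpoints X"
      using differentiable_imp_locally_affine[of x t] xty(1,2) XPL unfolding breakpoints_def by auto
  qed
  have chain: "transition_chain G \<longleftrightarrow> has_chain extend G" using transition_chain_iff[OF GPL] .
  have overlap: "one_sided_overlap G \<longleftrightarrow> has_left_overlap extend G \<or> has_right_overlap extend G"
    using one_sided_overlap_iff[OF GPL] .
  have tower: "infinite_tower G \<longleftrightarrow> has_tower extend G" using infinite_tower_iff[OF GPL] .
  have 1: "transition_chain G \<longrightarrow> one_sided_overlap G"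
    using chain overlap chain_imp_right_overlap[OF assms(3)] by blast
  have 2: "one_sided_overlap G \<longrightarrow> infinite_tower G"
    using overlap tower overlap_imp_tower[OF assms(3)] by blast
  have 3: "infinite_tower G \<longrightarrow> \<not> solvable ?G"
    using tower solv tower_imp_derived_nontrivial[OF assms(3)] by blast
  have 4: "\<not> solvable ?G \<longrightarrow> transition_chain G"
    using solv bound chain by blast
  have "derived_length ?G \<le> card (breakpoints X)" if "solvable ?G"
  proof -
    \<comment> \<open>Solubility rules out towers, hence overlaps and chains, so the bound for
      groups without chains applies.\<close>
    have "(derived ?G ^^ card (breakpoints X)) (carrier ?G) = {\<one>\<^bsub>?G\<^esub>}"
      using bound chain 1 2 3 that der by simp
    then show ?thesis unfolding derived_length_def by (rule Least_le)
  qed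
  with 1 2 3 4 show ?thesis by blast
qed

end
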